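(* Let $M$ be a $6$-manifold equipped with an $\mathrm{SU}(3)$-structure $(\Omega,\Upsilon)$ with torsion forms $\tau_0,\widehat\tau_0,\tau_2,\widehat\tau_2,\tau_3,\tau_4,\tau_5$, and let $\theta\in[0,2\pi)$. If a special Lagrangian $3$-fold $\Sigma$ of phase $\theta$ exists in $M$, then at every point of $\Sigma$ $$\widehat\tau_0\sin(\theta)+\tau_0\cos(\theta)=\tfrac{\sqrt3}{6}\Big(\sin(\tfrac\theta3)\,[(\tau_3)_0'']^\ddag-\cos(\tfrac\theta3)\,[(\tau_3)_0']^\dagger\Big),$$ where the refined torsion forms are taken relative to the splitting $T_x^*M=\mathsf T\oplus\mathsf N$ determined by $\mathsf T^\sharp=e^{-i\theta/3}\cdot T_x\Sigma$. In particular, if $\tau_3=0$, then the phase $\theta$ of every special Lagrangian $3$-fold in $M$ satisfies, at its points, the relation $\tan(\theta)=-\tau_0/\widehat\tau_0$, understood as $\widehat\tau_0\sin(\theta)=-\tau_0\cos(\theta)$.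
   Context: **Linear model.** On $V=\mathbb R^6$ with standard orthonormal basis $e_1,\dots,e_6$ and dual basis $e^1,\dots,e^6$, write $e^{ij}=e^i\wedge e^j$, etc. Let $J_0e_p=e_{p+3}$, $J_0 e_{p+3}=-e_p$ ($p=1,2,3$), $\Omega_0=e^{14}+e^{25}+e^{36}$, $\Upsilon_0=(e^1+ie^4)\wedge(e^2+ie^5)\wedge(e^3+ie^6)$. Forms $\Lambda^k(V^* )$ carry the inner product for which $\{e^I: I \text{ increasing}\}$ is orthonormal. **$\mathrm{SU}(3)$-structures.** An $\mathrm{SU}(3)$-structure on an oriented $6$-manifold $M$ is a pair $(\Omega,\Upsilon)\in\Omega^2(M)\oplus\Omega^3(M;\mathbb C)$ such that at each $x\in M$ there is a linear isomorphism $u:T_xM\to\mathbb R^6$ with $\Omega|_x=u^*\Omega_0$, $\Upsilon|_x=u^*\Upsilon_0$. It induces a Riemannian metric $g$ and an almost complex structure $J$ on $M$ (pull back the standard inner product and $J_0$ by any such $u$). A complex number $a+ib$ acts on $T_xM$ by $a\,\mathrm{Id}+bJ$. **Torsion forms.** Let $\Lambda^2_8=\{\beta\in\Lambda^2: \beta\wedge\mathrm{Re}\Upsilon=0,\ \beta\wedge\Omega^2=0\}$ and $\Lambda^3_{12}=\{\gamma\in\Lambda^3:\gamma\wedge\Omega=0,\ \gamma\wedge\mathrm{Re}\Upsilon=\gamma\wedge\mathrm{Im}\Upsilon=0\}$. The torsion forms are the unique $\tau_0,\widehat\tau_0\in\Gamma(\Lambda^0)$, $\tau_2,\widehat\tau_2\in\Gamma(\Lambda^2_8)$,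 $\tau_3\in\Gamma(\Lambda^3_{12})$, $\tau_4,\tau_5\in\Gamma(\Lambda^1)$ with $$d\Omega=3\tau_0\mathrm{Re}\Upsilon+3\widehat\tau_0\mathrm{Im}\Upsilon+\tau_3+\tau_4\wedge\Omega,$$ $$d\,\mathrm{Re}\Upsilon=2\widehat\tau_0\Omega^2+\tau_5\wedge\mathrm{Re}\Upsilon+\tau_2\wedge\Omega,$$ $$d\,\mathrm{Im}\Upsilon=-2\tau_0\Omega^2+(\tau_5\circ J)\wedge\mathrm{Re}\Upsilon+\widehat\tau_2\wedge\Omega.$$ **Special Lagrangians.** A $3$-plane $E\subset T_xM$ is special Lagrangian of phase $\theta$ if $\Omega|_E=0$ and $\mathrm{Im}(e^{-i\theta}\Upsilon)|_E=0$. A special Lagrangian $3$-fold of phase $\theta$ is an immersed $3$-dimensional submanifold $\Sigma\subset M$ all of whose tangent spaces are special Lagrangian of phase $\theta$. **Refined torsion forms.** For $x\in\Sigma$, the plane $\mathsf T^\sharp:=e^{-i\theta/3}\cdot T_x\Sigma$ is special Lagrangian of phase $0$; let $\mathsf N^\sharp$ be its orthogonal complement. Choose a basis $e_1,\dots,e_6$ of $T_xM$ identifying $(\Omega|_x,\Upsilon|_x)$ with $(\Omega_0,\Upsilon_0)$ and with $\mathsf T^\sharp=\mathrm{span}(e_1,e_2,e_3)$, $\mathsf N^\sharp=\mathrm{span}(e_4,e_5,e_6)$. Put $$\Theta_0=-\mathrm{Re}(\Upsilon_0)+4e^{123},\qquad \Delta_0=-\mathrm{Im}(\Upsilon_0)-4e^{456},$$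 which are orthogonal elements of $\Lambda^3_{12}$ of norm $2\sqrt3$, spanning the lines $(\Lambda^3_{12})_0'=\mathbb R\Theta_0$ and $(\Lambda^3_{12})_0''=\mathbb R\Delta_0$. Then $(\tau_3)_0'$ and $(\tau_3)_0''$ are the orthogonal projections of $\tau_3$ onto $(\Lambda^3_{12})_0'$ and $(\Lambda^3_{12})_0''$. The linear isometries $\dagger:(\Lambda^3_{12})_0'\to\mathbb R$ and $\ddag:(\Lambda^3_{12})_0''\to\mathbb R$ are determined by $(\Theta_0)^\dagger=2\sqrt3$ and $(\Delta_0)^\ddag=2\sqrt3$. *)

theory Defs
  imports "HOL-Analysis.Analysis"
begin

section \<open>Exterior algebra\<close>

text \<open>
  A \<open>k\<close>-form on \<open>'v\<close> is a function of a sequence \<open>v 0, v 1, \<dots>\<close> of vectors that only depends on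
  \<open>v 0, \<dots>, v (k - 1)\<close>, and is multilinear and alternating in these.
\<close>

type_synonym ('v, 'c) form = "(nat \<Rightarrow> 'v) \<Rightarrow> 'c"

definition alt_form :: "nat \<Rightarrow> ('v::real_vector, 'c::real_vector) form \<Rightarrow> bool" where
  "alt_form k \<alpha> \<longleftrightarrow>
     (\<forall>v w. (\<forall>i<k. v i = w i) \<longrightarrow> \<alpha> v = \<alpha> w) \<and>
     (\<forall>v. \<forall>i<k. linear (\<lambda>x. \<alpha> (v(i := x)))) \<and>
     (\<forall>v. \<forall>i<k. \<forall>j<k. i \<noteq> j \<and> v i = v j \<longrightarrow> \<alpha> v = 0)"

text \<open>Normalised so that \<open>e\<^sup>1 \<and> \<dots> \<and> e\<^sup>k\<close> takes the value 1 on \<open>e\<^sub>1, \<dots>, e\<^sub>k\<close>.\<close>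

definition wedge :: "nat \<Rightarrow> nat \<Rightarrow> ('v, 'c::real_normed_field) form \<Rightarrow> ('v, 'c) form \<Rightarrow> ('v, 'c) form" where
  "wedge k l \<alpha> \<beta> = (\<lambda>v.
     (\<Sum>p | p permutes {..<k + l}.
        of_int (sign p) * \<alpha> (\<lambda>i. v (p i)) * \<beta> (\<lambda>i. v (p (k + i)))) / (fact k * fact l))"

definition pull :: "('v \<Rightarrow> 'w) \<Rightarrow> ('w, 'c) form \<Rightarrow> ('v, 'c) form" where
  "pull u \<alpha> = (\<lambda>v. \<alpha> (\<lambda>i. u (v i)))"

definition vanishes_on :: "('v, 'c::zero) form \<Rightarrow> 'v set \<Rightarrow> bool" where
  "vanishes_on \<alpha> E \<longleftrightarrow> (\<forall>v. range v \<subseteq> E \<longrightarrow> \<alpha> v = 0)"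

definition Re_form :: "('v, complex) form \<Rightarrow> ('v, real) form" where
  "Re_form \<alpha> = (\<lambda>v. Re (\<alpha> v))"

definition Im_form :: "('v, complex) form \<Rightarrow> ('v, real) form" where
  "Im_form \<alpha> = (\<lambda>v. Im (\<alpha> v))"


section \<open>The linear model\<close>

text \<open>
  The index type \<open>6\<close> is \<open>\<int>/6\<int>\<close>, so the numeral \<open>6\<close> denotes its element \<open>0\<close> and
  \<open>1, \<dots>, 6\<close> are its six distinct elements.
\<close>

definition basis_vec :: "6 \<Rightarrow> real ^ 6" where
  "basis_vec i = axis i 1"

definition cov :: "6 \<Rightarrow> (real ^ 6, real) form" where
  "cov i = (\<lambda>v. v 0 $ i)"

definition J0 :: "real ^ 6 \<Rightarrow> real ^ 6" where
  "J0 v = (\<Sum>p\<in>{1, 2, 3}. (v $ p) *\<^sub>R basis_vec (p + 3) - (v $ (p + 3)) *\<^sub>R basis_vec p)"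

definition Omega0 :: "(real ^ 6, real) form" where
  "Omega0 = (\<lambda>v. wedge 1 1 (cov 1) (cov 4) v + wedge 1 1 (cov 2) (cov 5) v + wedge 1 1 (cov 3) (cov 6) v)"

definition dz :: "6 \<Rightarrow> (real ^ 6, complex) form" where
  "dz p = (\<lambda>v. complex_of_real (cov p v) + \<i> * complex_of_real (cov (p + 3) v))"

definition Upsilon0 :: "(real ^ 6, complex) form" where
  "Upsilon0 = wedge 2 1 (wedge 1 1 (dz 1) (dz 2)) (dz 3)"

definition cov3 :: "6 \<Rightarrow> 6 \<Rightarrow> 6 \<Rightarrow> (real ^ 6, real) form" where
  "cov3 i j k = wedge 2 1 (wedge 1 1 (cov i) (cov j)) (cov k)"

definition Theta0 :: "(real ^ 6, real) form" where
  "Theta0 = (\<lambda>v. - Re_form Upsilon0 v + 4 * cov3 1 2 3 v)"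

definition Delta0 :: "(real ^ 6, real) form" where
  "Delta0 = (\<lambda>v. - Im_form Upsilon0 v - 4 * cov3 4 5 6 v)"

definition vec3 :: "'v \<Rightarrow> 'v \<Rightarrow> 'v \<Rightarrow> nat \<Rightarrow> 'v" where
  "vec3 a b c = (\<lambda>i. if i = 0 then a else if i = 1 then b else c)"

text \<open>
  The inner product on 3-forms for which the \<open>e\<^sup>i\<^sup>j\<^sup>k\<close> with \<open>i < j < k\<close> are orthonormal; the
  coefficient of \<open>e\<^sup>i\<^sup>j\<^sup>k\<close> in a 3-form is its value on \<open>e\<^sub>i, e\<^sub>j, e\<^sub>k\<close>.
\<close>

definition form3_inner :: "(real ^ 6, real) form \<Rightarrow> (real ^ 6, real) form \<Rightarrow> real" where
  "form3_inner \<alpha> \<beta> = (\<Sum>i=1..6. \<Sum>j=i+1..6. \<Sum>k=j+1..(6::nat).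
     \<alpha> (vec3 (basis_vec (of_nat i)) (basis_vec (of_nat j)) (basis_vec (of_nat k))) *
     \<beta> (vec3 (basis_vec (of_nat i)) (basis_vec (of_nat j)) (basis_vec (of_nat k))))"

definition line_proj :: "(real ^ 6, real) form \<Rightarrow> (real ^ 6, real) form \<Rightarrow> (real ^ 6, real) form" where
  "line_proj \<alpha> \<gamma> = (\<lambda>v. form3_inner \<gamma> \<alpha> / form3_inner \<alpha> \<alpha> * \<alpha> v)"

text \<open>The linear maps on the lines spanned by \<open>Theta0\<close> and \<open>Delta0\<close> sending these to \<open>2 \<surd>3\<close>.\<close>

definition dagger :: "(real ^ 6, real) form \<Rightarrow> real" where
  "dagger \<gamma> = (THE a. \<gamma> = (\<lambda>v. a * Theta0 v)) * (2 * sqrt 3)"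

definition ddagger :: "(real ^ 6, real) form \<Rightarrow> real" where
  "ddagger \<gamma> = (THE a. \<gamma> = (\<lambda>v. a * Delta0 v)) * (2 * sqrt 3)"


section \<open>SU(3)-structures on a six-dimensional vector space\<close>

definition su3_frame ::
  "(real ^ 6, real) form \<Rightarrow> (real ^ 6, complex) form \<Rightarrow> (real ^ 6 \<Rightarrow> real ^ 6) \<Rightarrow> bool" where
  "su3_frame \<Omega> \<Upsilon> u \<longleftrightarrow> linear u \<and> bij u \<and> \<Omega> = pull u Omega0 \<and> \<Upsilon> = pull u Upsilon0"

text \<open>
  Two frames for the same \<open>(\<Omega>, \<Upsilon>)\<close> differ by an element of SU(3), which preserves \<open>J0\<close> and the
  standard inner product, so the choices below are immaterial.
\<close>

definition induced_J ::
  "(real ^ 6, real) form \<Rightarrow> (real ^ 6, complex) form \<Rightarrow> real ^ 6 \<Rightarrow> real ^ 6" where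
  "induced_J \<Omega> \<Upsilon> = (let u = (SOME u. su3_frame \<Omega> \<Upsilon> u) in inv u \<circ> J0 \<circ> u)"

definition induced_g ::
  "(real ^ 6, real) form \<Rightarrow> (real ^ 6, complex) form \<Rightarrow> real ^ 6 \<Rightarrow> real ^ 6 \<Rightarrow> real" where
  "induced_g \<Omega> \<Upsilon> v w = (let u = (SOME u. su3_frame \<Omega> \<Upsilon> u) in u v \<bullet> u w)"

definition complex_mult ::
  "(real ^ 6, real) form \<Rightarrow> (real ^ 6, complex) form \<Rightarrow> complex \<Rightarrow> real ^ 6 \<Rightarrow> real ^ 6" where
  "complex_mult \<Omega> \<Upsilon> z v = Re z *\<^sub>R v + Im z *\<^sub>R induced_J \<Omega> \<Upsilon> v"

definition Lambda2_8 ::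
  "(real ^ 6, real) form \<Rightarrow> (real ^ 6, complex) form \<Rightarrow> (real ^ 6, real) form set" where
  "Lambda2_8 \<Omega> \<Upsilon> = {\<beta>. alt_form 2 \<beta> \<and>
     wedge 2 3 \<beta> (Re_form \<Upsilon>) = (\<lambda>v. 0) \<and> wedge 2 4 \<beta> (wedge 2 2 \<Omega> \<Omega>) = (\<lambda>v. 0)}"

definition Lambda3_12 ::
  "(real ^ 6, real) form \<Rightarrow> (real ^ 6, complex) form \<Rightarrow> (real ^ 6, real) form set" where
  "Lambda3_12 \<Omega> \<Upsilon> = {\<gamma>. alt_form 3 \<gamma> \<and> wedge 3 2 \<gamma> \<Omega> = (\<lambda>v. 0) \<and>
     wedge 3 3 \<gamma> (Re_form \<Upsilon>) = (\<lambda>v. 0) \<and> wedge 3 3 \<gamma> (Im_form \<Upsilon>) = (\<lambda>v. 0)}"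

definition special_lagrangian_plane ::
  "(real ^ 6, real) form \<Rightarrow> (real ^ 6, complex) form \<Rightarrow> real \<Rightarrow> (real ^ 6) set \<Rightarrow> bool" where
  "special_lagrangian_plane \<Omega> \<Upsilon> \<theta> E \<longleftrightarrow>
     subspace E \<and> dim E = 3 \<and> vanishes_on \<Omega> E \<and> vanishes_on (Im_form (\<lambda>v. cis (- \<theta>) * \<Upsilon> v)) E"

text \<open>
  A basis of the tangent space is encoded by the isomorphism \<open>u\<close> that maps it to the standard basis:
  the \<open>p\<close>-th basis vector is \<open>inv u (basis_vec p)\<close>.
\<close>

definition adapted_frame ::
  "(real ^ 6, real) form \<Rightarrow> (real ^ 6, complex) form \<Rightarrow> (real ^ 6) set \<Rightarrow> (real ^ 6 \<Rightarrow> real ^ 6) \<Rightarrow> bool" where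
  "adapted_frame \<Omega> \<Upsilon> T u \<longleftrightarrow> su3_frame \<Omega> \<Upsilon> u \<and>
     T = span {inv u (basis_vec 1), inv u (basis_vec 2), inv u (basis_vec 3)} \<and>
     {w. \<forall>v\<in>T. induced_g \<Omega> \<Upsilon> v w = 0} = span {inv u (basis_vec 4), inv u (basis_vec 5), inv u (basis_vec 6)}"

text \<open>Components of a 3-form, expressed in the basis given by the adapted frame \<open>u\<close>.\<close>

definition refined' :: "(real ^ 6 \<Rightarrow> real ^ 6) \<Rightarrow> (real ^ 6, real) form \<Rightarrow> (real ^ 6, real) form" where
  "refined' u \<gamma> = line_proj Theta0 (pull (inv u) \<gamma>)"

definition refined'' :: "(real ^ 6 \<Rightarrow> real ^ 6) \<Rightarrow> (real ^ 6, real) form \<Rightarrow> (real ^ 6, real) form" where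
  "refined'' u \<gamma> = line_proj Delta0 (pull (inv u) \<gamma>)"


section \<open>Smooth manifolds\<close>

text \<open>\<open>C\<^sup>k\<close> and smooth maps on an open subset \<open>S\<close> of a normed space.\<close>

primrec Ck_on :: "nat \<Rightarrow> 'a::real_normed_vector set \<Rightarrow> ('a \<Rightarrow> 'b::real_normed_vector) \<Rightarrow> bool" where
  "Ck_on 0 S f \<longleftrightarrow> continuous_on S f"
| "Ck_on (Suc k) S f \<longleftrightarrow>
     (\<forall>x\<in>S. f differentiable at x) \<and> (\<forall>v. Ck_on k S (\<lambda>x. frechet_derivative f (at x) v))"

definition smooth_on :: "'a::real_normed_vector set \<Rightarrow> ('a \<Rightarrow> 'b::real_normed_vector) \<Rightarrow> bool" where
  "smooth_on S f \<longleftrightarrow> (\<forall>k. Ck_on k S f)"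

type_synonym ('m, 'n) chart = "'m set \<times> ('m \<Rightarrow> real ^ 'n)"

definition chart_img :: "('m, 'n) chart \<Rightarrow> (real ^ 'n) set" where
  "chart_img c = snd c ` fst c"

definition chart_inv :: "('m, 'n) chart \<Rightarrow> real ^ 'n \<Rightarrow> 'm" where
  "chart_inv c = inv_into (fst c) (snd c)"

definition transition :: "('m, 'n) chart \<Rightarrow> ('m, 'n) chart \<Rightarrow> real ^ 'n \<Rightarrow> real ^ 'n" where
  "transition c c' = snd c' \<circ> chart_inv c"

definition second_countable_space :: "'m topology \<Rightarrow> bool" where
  "second_countable_space X \<longleftrightarrow> (\<exists>\<B>. countable \<B> \<and> (\<forall>V\<in>\<B>. openin X V) \<and>
     (\<forall>U x. openin X U \<and> x \<in> U \<longrightarrow> (\<exists>V\<in>\<B>. x \<in> V \<and> V \<subseteq> U)))"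

definition smooth_manifold :: "'m topology \<Rightarrow> ('m, 'n::finite) chart set \<Rightarrow> bool" where
  "smooth_manifold X A \<longleftrightarrow>
     Hausdorff_space X \<and> second_countable_space X \<and>
     (\<forall>c\<in>A. openin X (fst c) \<and> open (chart_img c) \<and>
        homeomorphic_map (subtopology X (fst c)) (top_of_set (chart_img c)) (snd c)) \<and>
     (\<Union>c\<in>A. fst c) = topspace X \<and>
     (\<forall>c\<in>A. \<forall>c'\<in>A. smooth_on (snd c ` (fst c \<inter> fst c')) (transition c c'))"

definition smooth_function :: "('m, 'n::finite) chart set \<Rightarrow> ('m \<Rightarrow> real) \<Rightarrow> bool" where
  "smooth_function A h \<longleftrightarrow> (\<forall>c\<in>A. smooth_on (chart_img c) (h \<circ> chart_inv c))"

text \<open>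
  A differential form is given by its local representatives \<open>\<omega> c\<close> in the charts \<open>c\<close> of the atlas; these
  are related by pullback along the transition maps. Via the chart \<open>c\<close>, the tangent space at a
  point \<open>x\<close> is identified with \<open>real ^ 'n\<close>.
\<close>

type_synonym ('m, 'n, 'c) dform = "('m, 'n) chart \<Rightarrow> real ^ 'n \<Rightarrow> (real ^ 'n, 'c) form"

definition diff_form ::
  "('m, 'n::finite) chart set \<Rightarrow> nat \<Rightarrow> ('m, 'n, 'c::real_normed_vector) dform \<Rightarrow> bool" where
  "diff_form A k \<omega> \<longleftrightarrow>
     (\<forall>c\<in>A. (\<forall>y\<in>chart_img c. alt_form k (\<omega> c y)) \<and> (\<forall>v. smooth_on (chart_img c) (\<lambda>y. \<omega> c y v))) \<and>
     (\<forall>c\<in>A. \<forall>c'\<in>A. \<forall>y\<in>snd c ` (fst c \<inter> fst c').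
        \<omega> c y = pull (frechet_derivative (transition c c') (at y)) (\<omega> c' (transition c c' y)))"

text \<open>
  Exterior derivative of a \<open>k\<close>-form on an open subset of a normed space: the invariant formula, evaluated
  on constant vector fields.
\<close>

definition ext_deriv ::
  "nat \<Rightarrow> ('v::real_normed_vector \<Rightarrow> ('v, real) form) \<Rightarrow> 'v \<Rightarrow> ('v, real) form" where
  "ext_deriv k \<omega> y = (\<lambda>v. \<Sum>i\<le>k. (- 1) ^ i *
     frechet_derivative (\<lambda>z. \<omega> z (\<lambda>j. if j < i then v j else v (Suc j))) (at y) (v i))"


section \<open>SU(3)-structures on six-manifolds and their torsion forms\<close>

definition su3_structure ::
  "('m, 6) chart set \<Rightarrow> ('m, 6, real) dform \<Rightarrow> ('m, 6, complex) dform \<Rightarrow> bool" where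
  "su3_structure A \<Omega> \<Upsilon> \<longleftrightarrow> diff_form A 2 \<Omega> \<and> diff_form A 3 \<Upsilon> \<and>
     (\<forall>c\<in>A. \<forall>y\<in>chart_img c. \<exists>u. su3_frame (\<Omega> c y) (\<Upsilon> c y) u)"

text \<open>The arguments \<open>t0\<close>, \<open>t0h\<close>, \<open>t2\<close>, \<open>t2h\<close> stand for \<open>\<tau>\<^sub>0\<close>, \<open>\<tau>\<^sub>0\<close> hat, \<open>\<tau>\<^sub>2\<close>, \<open>\<tau>\<^sub>2\<close> hat.\<close>

definition torsion_forms ::
  "('m, 6) chart set \<Rightarrow> ('m, 6, real) dform \<Rightarrow> ('m, 6, complex) dform \<Rightarrow>
   ('m \<Rightarrow> real) \<Rightarrow> ('m \<Rightarrow> real) \<Rightarrow> ('m, 6, real) dform \<Rightarrow> ('m, 6, real) dform \<Rightarrow>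
   ('m, 6, real) dform \<Rightarrow> ('m, 6, real) dform \<Rightarrow> ('m, 6, real) dform \<Rightarrow> bool" where
  "torsion_forms A \<Omega> \<Upsilon> t0 t0h t2 t2h t3 t4 t5 \<longleftrightarrow>
     smooth_function A t0 \<and> smooth_function A t0h \<and>
     diff_form A 2 t2 \<and> diff_form A 2 t2h \<and> diff_form A 3 t3 \<and> diff_form A 1 t4 \<and> diff_form A 1 t5 \<and>
     (\<forall>c\<in>A. \<forall>y\<in>chart_img c.
        t2 c y \<in> Lambda2_8 (\<Omega> c y) (\<Upsilon> c y) \<and>
        t2h c y \<in> Lambda2_8 (\<Omega> c y) (\<Upsilon> c y) \<and>
        t3 c y \<in> Lambda3_12 (\<Omega> c y) (\<Upsilon> c y) \<and>
        ext_deriv 2 (\<Omega> c) y = (\<lambda>v.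
          3 * t0 (chart_inv c y) * Re_form (\<Upsilon> c y) v + 3 * t0h (chart_inv c y) * Im_form (\<Upsilon> c y) v
          + t3 c y v + wedge 1 2 (t4 c y) (\<Omega> c y) v) \<and>
        ext_deriv 3 (\<lambda>z. Re_form (\<Upsilon> c z)) y = (\<lambda>v.
          2 * t0h (chart_inv c y) * wedge 2 2 (\<Omega> c y) (\<Omega> c y) v
          + wedge 1 3 (t5 c y) (Re_form (\<Upsilon> c y)) v + wedge 2 2 (t2 c y) (\<Omega> c y) v) \<and>
        ext_deriv 3 (\<lambda>z. Im_form (\<Upsilon> c z)) y = (\<lambda>v.
          - 2 * t0 (chart_inv c y) * wedge 2 2 (\<Omega> c y) (\<Omega> c y) v
          + wedge 1 3 (pull (induced_J (\<Omega> c y) (\<Upsilon> c y)) (t5 c y)) (Re_form (\<Upsilon> c y)) v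
          + wedge 2 2 (t2h c y) (\<Omega> c y) v))"


section \<open>Immersed special Lagrangian 3-folds\<close>

definition local_rep ::
  "('s \<Rightarrow> 'm) \<Rightarrow> ('s, 'k::finite) chart \<Rightarrow> ('m, 'n::finite) chart \<Rightarrow> real ^ 'k \<Rightarrow> real ^ 'n" where
  "local_rep f b c = snd c \<circ> f \<circ> chart_inv b"

definition smooth_map ::
  "'s topology \<Rightarrow> ('s, 'k::finite) chart set \<Rightarrow> 'm topology \<Rightarrow> ('m, 'n::finite) chart set \<Rightarrow>
   ('s \<Rightarrow> 'm) \<Rightarrow> bool" where
  "smooth_map Y B X A f \<longleftrightarrow> continuous_map Y X f \<and>
     (\<forall>b\<in>B. \<forall>c\<in>A. smooth_on (snd b ` {p \<in> fst b. f p \<in> fst c}) (local_rep f b c))"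

text \<open>The differential of \<open>f\<close> at \<open>p\<close> in the charts \<open>b\<close> around \<open>p\<close> and \<open>c\<close> around \<open>f p\<close>.\<close>

definition local_diff ::
  "('s \<Rightarrow> 'm) \<Rightarrow> ('s, 'k::finite) chart \<Rightarrow> ('m, 'n::finite) chart \<Rightarrow> 's \<Rightarrow> real ^ 'k \<Rightarrow> real ^ 'n" where
  "local_diff f b c p = frechet_derivative (local_rep f b c) (at (snd b p))"

definition immersion ::
  "'s topology \<Rightarrow> ('s, 'k::finite) chart set \<Rightarrow> 'm topology \<Rightarrow> ('m, 'n::finite) chart set \<Rightarrow>
   ('s \<Rightarrow> 'm) \<Rightarrow> bool" where
  "immersion Y B X A f \<longleftrightarrow> smooth_map Y B X A f \<and>
     (\<forall>b\<in>B. \<forall>c\<in>A. \<forall>p\<in>fst b. f p \<in> fst c \<longrightarrow> inj (local_diff f b c p))"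

definition special_lagrangian_3fold ::
  "'m topology \<Rightarrow> ('m, 6) chart set \<Rightarrow> ('m, 6, real) dform \<Rightarrow> ('m, 6, complex) dform \<Rightarrow> real \<Rightarrow>
   's topology \<Rightarrow> ('s, 3) chart set \<Rightarrow> ('s \<Rightarrow> 'm) \<Rightarrow> bool" where
  "special_lagrangian_3fold X A \<Omega> \<Upsilon> \<theta> Y B f \<longleftrightarrow>
     smooth_manifold Y B \<and> immersion Y B X A f \<and>
     (\<forall>b\<in>B. \<forall>c\<in>A. \<forall>p\<in>fst b. f p \<in> fst c \<longrightarrow>
        special_lagrangian_plane (\<Omega> c (snd c (f p))) (\<Upsilon> c (snd c (f p))) \<theta> (range (local_diff f b c p)))"

end

theory Submission
  imports Defs
begin

text \<open>
A special Lagrangian immersion \<open>f\<close> satisfies \<open>f\<^sup>*\<Omega> = 0\<close>, so \<open>d\<Omega>\<close> also vanishes on every tangent plane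
\<open>E\<close> of \<open>f\<close>. Restricting the formula \<open>d\<Omega> = 3\<tau>\<^sub>0 Re \<Upsilon> + 3\<tau>\<^sub>0h Im \<Upsilon> + \<tau>\<^sub>3 + \<tau>\<^sub>4 \<and> \<Omega>\<close> to \<open>E\<close> kills the
last term. In an adapted frame, \<open>E\<close> is spanned by the vectors \<open>e\<^bsup>i\<theta>/3\<^esup> e\<^sub>p\<close> for \<open>p = 1, 2, 3\<close>. There
\<open>\<Upsilon>\<close> takes the value \<open>e\<^bsup>i\<theta>\<^esup>\<close>, so that \<open>3\<tau>\<^sub>0 cos \<theta> + 3\<tau>\<^sub>0h sin \<theta>\<close> is minus the value of \<open>\<tau>\<^sub>3\<close>.

It remains to express that value through the two refined components. Expanding by trilinearity gives
eight components of \<open>\<tau>\<^sub>3\<close>, weighted by \<open>cos\<^sup>a(\<theta>/3) sin\<^sup>b(\<theta>/3)\<close> with \<open>a + b = 3\<close>. Two linear relations hold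
on \<open>\<Lambda>\<^sup>3\<^sub>1\<^sub>2\<close> (lemma \<open>Lambda3_12_component_relations\<close>): the three components with one index above 3 add up
to the component 456, and the three with two such indices add up to the component 123. With
\<open>cos\<^sup>2 + sin\<^sup>2 = 1\<close> the value becomes \<open>cos(\<theta>/3)\<close> times the component 123 plus \<open>sin(\<theta>/3)\<close> times the
component 456 (\<open>rotated_plane_value\<close>). The same two relations show that the projections to the lines of
\<open>Theta0\<close> and \<open>Delta0\<close> see exactly these two components (\<open>dagger_refined\<close>).

Three ingredients need work. The component relations come from wedging with \<open>Re \<Upsilon>\<close> and \<open>Im \<Upsilon>\<close>; these products
are sums over 720 permutations, of which only eight classes matter (\<open>wedge_3_3_sum_over_transversals\<close>). The
vanishing of \<open>d\<Omega>\<close> is the chain rule together with the symmetry of second derivatives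
(\<open>ext_deriv_2_pullback_eq_0\<close>). An adapted frame exists because an orthonormal basis of a special Lagrangian
plane is a unitary basis on which \<open>\<Upsilon>\<close> is \<open>1\<close>, up to the sign of one vector (\<open>adapted_frame_exists\<close>); that
the induced metric and complex structure can be computed in any frame follows since \<open>\<Upsilon>\<close> determines \<open>J\<close>, and
\<open>\<Omega>\<close> and \<open>J\<close> determine \<open>g\<close>.
\<close>

section \<open>Alternating forms and wedge products\<close>

lemma wedge_pull: "wedge k l (pull u \<alpha>) (pull u \<beta>) = pull u (wedge k l \<alpha> \<beta>)"
  by (simp add: wedge_def pull_def)

lemma alt_form_cong: "alt_form k \<alpha> \<Longrightarrow> (\<And>i. i < k \<Longrightarrow> v i = w i) \<Longrightarrow> \<alpha> v = \<alpha> w"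
  unfolding alt_form_def by blast

text \<open>
Polarisation: expand the value on a sequence that has the sum of the two vectors in both slots.
\<close>

lemma alt_form_swap:
  assumes a: "alt_form k \<alpha>" and ij: "i < k" "j < k" "i \<noteq> j"
  shows "\<alpha> (\<lambda>m. v (Transposition.transpose i j m)) = - \<alpha> v"
proof -
  have lin: "linear (\<lambda>x. \<alpha> (w(n := x)))" if "n < k" for w n
    using a that unfolding alt_form_def by blast
  have zero: "\<alpha> (w(i := x, j := x)) = 0" for w x
  proof -
    have "(w(i := x, j := x)) i = (w(i := x, j := x)) j" by auto
    then show ?thesis using a ij unfolding alt_form_def by blast
  qed
  let ?F = "\<lambda>x y. \<alpha> (v(i := x, j := y))"
  have add1: "?F (x + x') y = ?F x y + ?F x' y" for x x' y
    using linear_add[OF lin[OF ij(1), of "v(j := y)"], of x x'] ij(3)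
    by (simp add: fun_upd_twist)
  have add2: "?F x (y + y') = ?F x y + ?F x y'" for x y y'
    using linear_add[OF lin[OF ij(2), of "v(i := x)"], of y y'] by simp
  have "0 = ?F (v i + v j) (v i + v j)" using zero by simp
  also have "\<dots> = ?F (v i) (v j) + ?F (v j) (v i)"
    by (simp only: add1 add2) (simp only: zero add_0_left add_0_right add.commute)
  also have "?F (v i) (v j) = \<alpha> v" by simp
  also have "v(i := v j, j := v i) = (\<lambda>m. v (Transposition.transpose i j m))"
    by (auto simp: fun_eq_iff Transposition.transpose_def)
  finally show ?thesis by (metis minus_unique)
qed

text \<open>
Only the slots in \<open>S\<close> need to be antisymmetric; this is used on both blocks of a wedge product, where the
second form reads the slots from \<open>k\<close> onwards.
\<close>

lemma antisymmetric_permute: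
  fixes F :: "(nat \<Rightarrow> 'v) \<Rightarrow> real"
  assumes "\<And>w i j. i \<in> S \<Longrightarrow> j \<in> S \<Longrightarrow> i \<noteq> j \<Longrightarrow> F (\<lambda>m. w (Transposition.transpose i j m)) = - F w"
    and "finite S" "q permutes S"
  shows "F (\<lambda>m. w (q m)) = of_int (sign q) * F w"
  using assms(2,3)
proof (induction rule: permutes_rev_induct)
  case id
  then show ?case by simp
next
  case (swap a b p)
  have "permutation p" using swap.hyps assms(2) by (auto simp: permutation_permutes)
  then have "sign (p \<circ> Transposition.transpose a b) = - sign p"
    using swap.hyps by (simp add: sign_compose permutation_swap_id sign_swap_id)
  then show ?case
    using assms(1)[of a b "\<lambda>m. w (p m)"] swap by (simp add: comp_def)
qed

text \<open>
A permutation that preserves the first block of slots also preserves the second one, and hence is the product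
of its restrictions to the two blocks.
\<close>

lemma block_permutation_split:
  fixes k l :: nat
  assumes q: "q permutes {..<k + l}" and img: "q ` {..<k} = {..<k}"
  obtains q1 q2 where "q1 permutes {..<k}" "q2 permutes {k..<k+l}" "q = q1 \<circ> q2"
    "sign q = sign q1 * sign q2" "\<And>i. i < k \<Longrightarrow> q i = q1 i" "\<And>i. i \<ge> k \<Longrightarrow> q i = q2 i"
proof -
  define q1 where "q1 i = (if i < k then q i else i)" for i
  define q2 where "q2 i = (if i < k then i else q i)" for i
  have inj: "inj q" using q by (rule permutes_inj)
  have imgu: "q ` {..<k+l} = {..<k+l}" using q by (rule permutes_image)
  have split: "{k..<k+l} = {..<k+l} - {..<k}" by auto
  have img2: "q ` {k..<k+l} = {k..<k+l}"
    unfolding split by (simp only: image_set_diff[OF inj] img imgu)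
  have "bij_betw q1 {..<k} {..<k}"
    using img by (subst bij_betw_cong[of _ _ q]) (simp_all add: q1_def bij_betw_def inj_on_subset[OF inj])
  then have p1: "q1 permutes {..<k}" by (rule bij_imp_permutes) (simp add: q1_def)
  have "bij_betw q2 {k..<k+l} {k..<k+l}"
    using img2 by (subst bij_betw_cong[of _ _ q]) (simp_all add: q2_def bij_betw_def inj_on_subset[OF inj])
  then have p2: "q2 permutes {k..<k+l}"
    by (rule bij_imp_permutes) (use q in \<open>auto simp: q2_def permutes_def\<close>)
  have e: "q = q1 \<circ> q2"
  proof
    fix i show "q i = (q1 \<circ> q2) i"
    proof (cases "i < k")
      case False
      then have "q i \<ge> k"
        using imageI[of i "{k..<k+l}" q] permutes_not_in[OF q, of i] False by (cases "i < k + l") (simp_all add: img2)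
      then show ?thesis using False by (simp add: q1_def q2_def)
    qed (simp add: q1_def q2_def)
  qed
  have "sign q = sign q1 * sign q2"
    unfolding e using p1 p2 by (intro sign_compose) (auto simp: permutation_permutes)
  show thesis by (rule that[OF p1 p2 e \<open>sign q = _\<close>]) (simp_all add: q1_def q2_def)
qed

definition wedge_term ::
  "nat \<Rightarrow> nat \<Rightarrow> ('v, real) form \<Rightarrow> ('v, real) form \<Rightarrow> (nat \<Rightarrow> 'v) \<Rightarrow> (nat \<Rightarrow> nat) \<Rightarrow> real" where
  "wedge_term k l \<alpha> \<beta> v p =
     of_int (sign p) * \<alpha> (\<lambda>i. v (p i)) * \<beta> (\<lambda>i. v (p (k + i)))"

text \<open>
The summand of a wedge product only depends on which slots go to the first factor: permuting the slots inside
a block changes the sign of the permutation and the value of one factor alike.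
\<close>

lemma wedge_term_const_on_class:
  assumes a: "alt_form k \<alpha>" and b: "alt_form l \<beta>"
    and p: "p permutes {..<k + l}" and s: "\<sigma> permutes {..<k + l}"
    and img: "p ` {..<k} = \<sigma> ` {..<k}"
  shows "wedge_term k l \<alpha> \<beta> v p = wedge_term k l \<alpha> \<beta> v \<sigma>"
proof -
  define q where "q = inv \<sigma> \<circ> p"
  have q: "q permutes {..<k + l}"
    unfolding q_def using p s by (intro permutes_compose permutes_inv)
  have pq: "p = \<sigma> \<circ> q"
    unfolding q_def using permutes_surj[OF s] by (simp add: fun_eq_iff surj_f_inv_f)
  have "q ` {..<k} = {..<k}"
    unfolding q_def image_comp[symmetric] img using permutes_inj[OF s] by (simp add: image_inv_f_f)
  then obtain q1 q2 where
    q12: "q1 permutes {..<k}" "q2 permutes {k..<k+l}" "q = q1 \<circ> q2" "sign q = sign q1 * sign q2"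
    "\<And>i. i < k \<Longrightarrow> q i = q1 i" "\<And>i. i \<ge> k \<Longrightarrow> q i = q2 i"
    by (rule block_permutation_split[OF q]) (rule that; assumption)
  have "\<alpha> (\<lambda>i. v (p i)) = \<alpha> (\<lambda>i. (\<lambda>m. v (\<sigma> m)) (q1 i))"
    by (rule alt_form_cong[OF a]) (simp add: pq q12(5))
  also have "\<dots> = of_int (sign q1) * \<alpha> (\<lambda>m. v (\<sigma> m))"
    by (rule antisymmetric_permute[where S = "{..<k}"]) (use q12(1) alt_form_swap[OF a] in auto)
  finally have 1: "\<alpha> (\<lambda>i. v (p i)) = of_int (sign q1) * \<alpha> (\<lambda>m. v (\<sigma> m))" .
  have "\<beta> (\<lambda>i. v (p (k + i))) = (\<lambda>w. \<beta> (\<lambda>i. w (k + i))) (\<lambda>i. (\<lambda>m. v (\<sigma> m)) (q2 i))"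
    using q12(6) unfolding pq by simp
  also have "\<dots> = of_int (sign q2) * \<beta> (\<lambda>i. v (\<sigma> (k + i)))"
  proof (rule antisymmetric_permute[where S = "{k..<k+l}"])
    fix w :: "nat \<Rightarrow> 'a" and i j assume ij: "i \<in> {k..<k+l}" "j \<in> {k..<k+l}" "i \<noteq> j"
    have "(\<lambda>m. w (Transposition.transpose i j (k + m))) = (\<lambda>m. w (k + Transposition.transpose (i-k) (j-k) m))"
      using ij by (auto simp: fun_eq_iff Transposition.transpose_def)
    then show "\<beta> (\<lambda>m. w (Transposition.transpose i j (k + m))) = - \<beta> (\<lambda>m. w (k + m))"
      using alt_form_swap[OF b, of "i-k" "j-k" "\<lambda>m. w (k + m)"] ij by auto
  qed (use q12(2) in auto)
  finally have 2: "\<beta> (\<lambda>i. v (p (k + i))) = of_int (sign q2) * \<beta> (\<lambda>i. v (\<sigma> (k + i)))" .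
  have "sign p = sign \<sigma> * sign q"
    unfolding pq using s q by (intro sign_compose) (auto simp: permutation_permutes)
  moreover have "real_of_int (sign q) * of_int (sign q1) * of_int (sign q2) = 1"
    unfolding q12(4) by (cases q1 rule: sign_cases; cases q2 rule: sign_cases) auto
  ultimately show ?thesis unfolding wedge_term_def 1 2 by simp
qed

text \<open>
Composition with \<open>\<sigma>\<close> is a bijection. So the classes enter a wedge product with the same multiplicity,
which cancels when the product vanishes.
\<close>

lemma card_permutation_class:
  fixes k l :: nat
  assumes s: "\<sigma> permutes {..<k + l}"
  shows "card {p. p permutes {..<k + l} \<and> p ` {..<k} = \<sigma> ` {..<k}} =
    card {p. p permutes {..<k + l} \<and> p ` {..<k} = {..<k}}"
proof (rule bij_betw_same_card, rule bij_betwI)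
  have inv_img: "(inv \<sigma> \<circ> p) ` {..<k} = {..<k}" if "p ` {..<k} = \<sigma> ` {..<k}" for p
    unfolding image_comp[symmetric] that using permutes_inj[OF s] by (simp add: image_inv_f_f)
  have comp_img: "(\<sigma> \<circ> p) ` {..<k} = \<sigma> ` {..<k}" if "p ` {..<k} = {..<k}" for p
    unfolding image_comp[symmetric] that ..
  show "(\<lambda>p. inv \<sigma> \<circ> p) \<in> {p. p permutes {..<k + l} \<and> p ` {..<k} = \<sigma> ` {..<k}} \<rightarrow>
     {p. p permutes {..<k + l} \<and> p ` {..<k} = {..<k}}"
    using s by (intro funcsetI CollectI conjI permutes_compose permutes_inv inv_img) auto
  show "(\<lambda>p. \<sigma> \<circ> p) \<in> {p. p permutes {..<k + l} \<and> p ` {..<k} = {..<k}} \<rightarrow>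
     {p. p permutes {..<k + l} \<and> p ` {..<k} = \<sigma> ` {..<k}}"
    using s by (intro funcsetI CollectI conjI permutes_compose comp_img) auto
  show "\<sigma> \<circ> (inv \<sigma> \<circ> p) = p" for p by (simp only: o_assoc permutes_inv_o[OF s] id_o)
  show "inv \<sigma> \<circ> (\<sigma> \<circ> p) = p" for p by (simp only: o_assoc permutes_inv_o[OF s] id_o)
qed

section \<open>The model forms in coordinates\<close>

lemma exhaust_6: "x = 1 \<or> x = 2 \<or> x = 3 \<or> x = 4 \<or> x = 5 \<or> x = 6" for x :: 6
proof (induct x)
  case (of_int z)
  then have "0 <= z" and "z < 6" by simp_all
  then have "z = 0 \<or> z = 1 \<or> z = 2 \<or> z = 3 \<or> z = 4 \<or> z = 5" by arith
  then show ?case by auto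
qed

lemma UNIV_6: "(UNIV::6 set) = {1,2,3,4,5,6}"
  using exhaust_6 by auto

lemma forall_6: "(\<forall>i::6. P i) \<longleftrightarrow> P 1 \<and> P 2 \<and> P 3 \<and> P 4 \<and> P 5 \<and> P 6"
  by (metis (full_types) exhaust_6)

lemma sum_6: "sum f (UNIV::6 set) = f 1 + f 2 + f 3 + f 4 + f 5 + f 6"
  unfolding UNIV_6 by (simp add: ac_simps)

lemma vec6_eq_iff: "(x::'a^6) = y \<longleftrightarrow> x$1 = y$1 \<and> x$2 = y$2 \<and> x$3 = y$3 \<and> x$4 = y$4 \<and> x$5 = y$5 \<and> x$6 = y$6"
  unfolding vec_eq_iff forall_6 ..

lemma wedge_1_1:
  "wedge 1 1 \<alpha> \<beta> v = \<alpha> v * \<beta> (\<lambda>i. v (1 + i)) -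
     \<alpha> (\<lambda>i. v (Transposition.transpose 0 1 i)) * \<beta> (\<lambda>i. v (Transposition.transpose 0 1 (1 + i)))"
proof -
  have s: "{..<1 + 1} = insert 0 (insert (1::nat) {})" by auto
  show ?thesis
    unfolding wedge_def s
    by (simp add: sum_over_permutations_insert sign_compose permutation_swap_id sign_swap_id)
qed

lemma Omega0_eq:
  "Omega0 v = (v 0 $ 1 * v 1 $ 4 - v 0 $ 4 * v 1 $ 1) + (v 0 $ 2 * v 1 $ 5 - v 0 $ 5 * v 1 $ 2)
     + (v 0 $ 3 * v 1 $ 6 - v 0 $ 6 * v 1 $ 3)"
  unfolding Omega0_def wedge_1_1 cov_def by simp

lemma wedge_2_1_decomposable:
  fixes a b c :: "'v \<Rightarrow> 'c :: real_normed_field"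
  shows "wedge 2 1 (wedge 1 1 (\<lambda>v. a (v 0)) (\<lambda>v. b (v 0))) (\<lambda>v. c (v 0)) v =
     a (v 0) * b (v 1) * c (v 2) + a (v 1) * b (v 2) * c (v 0) + a (v 2) * b (v 0) * c (v 1)
     - a (v 0) * b (v 2) * c (v 1) - a (v 1) * b (v 0) * c (v 2) - a (v 2) * b (v 1) * c (v 0)"
proof -
  have s: "{..<2 + 1} = insert 0 (insert (1::nat) (insert 2 {}))" by auto
  show ?thesis
    unfolding wedge_def[of 2 1] s wedge_1_1
    by (simp add: sum_over_permutations_insert sign_compose permutation_swap_id permutation_compose sign_swap_id
       Transposition.transpose_def) (simp add: field_simps)
qed

text \<open>
The identification of \<open>\<real>\<^sup>6\<close> with \<open>\<complex>\<^sup>3\<close> under which \<open>J0\<close> is multiplication by \<open>\<i>\<close> and \<open>Upsilon0\<close> is the complex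
determinant.
\<close>

definition cplx_coords :: "real ^ 6 \<Rightarrow> complex ^ 3" where
  "cplx_coords x = vector [Complex (x$1) (x$4), Complex (x$2) (x$5), Complex (x$3) (x$6)]"

lemma Upsilon0_eq_det:
  "Upsilon0 v = det (vector [cplx_coords (v 0), cplx_coords (v 1), cplx_coords (v 2)] :: complex^3^3)"
proof -
  let ?z = "\<lambda>p (x::real^6). complex_of_real (x $ p) + \<i> * complex_of_real (x $ (p + 3))"
  have "Upsilon0 v = wedge 2 1 (wedge 1 1 (\<lambda>v. ?z 1 (v 0)) (\<lambda>v. ?z 2 (v 0))) (\<lambda>v. ?z 3 (v 0)) v"
    unfolding Upsilon0_def dz_def cov_def ..
  also have "\<dots> = det (vector [cplx_coords (v 0), cplx_coords (v 1), cplx_coords (v 2)] :: complex^3^3)"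
    unfolding wedge_2_1_decomposable[where a = "?z 1" and b = "?z 2" and c = "?z 3"]
      det_3 cplx_coords_def vector_3 Complex_eq by simp
  finally show ?thesis .
qed

lemma cov3_eq:
  "cov3 i j k v = v 0 $ i * v 1 $ j * v 2 $ k + v 1 $ i * v 2 $ j * v 0 $ k + v 2 $ i * v 0 $ j * v 1 $ k
     - v 0 $ i * v 2 $ j * v 1 $ k - v 1 $ i * v 0 $ j * v 2 $ k - v 2 $ i * v 1 $ j * v 0 $ k"
  unfolding cov3_def cov_def
  by (rule wedge_2_1_decomposable[where a = "\<lambda>x. x $ i" and b = "\<lambda>x. x $ j" and c = "\<lambda>x. x $ k"])


section \<open>Component relations in the space of primitive 3-forms\<close>

lemma vec3_nth [simp]: "vec3 a b c 0 = a" "vec3 a b c (Suc 0) = b" "vec3 a b c 1 = b" "vec3 a b c 2 = c"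
  by (simp_all add: vec3_def)

lemma alt_form_vec3: "alt_form 3 \<alpha> \<Longrightarrow> \<alpha> v = \<alpha> (vec3 (v 0) (v 1) (v 2))"
  by (erule alt_form_cong) (auto simp: vec3_def less_Suc_eq numeral_3_eq_3 numeral_2_eq_2)

text \<open>
The permutations that exchange \<open>0 \<leftrightarrow> 3\<close>, \<open>1 \<leftrightarrow> 4\<close>, \<open>2 \<leftrightarrow> 5\<close> as prescribed by the three flags. The images of
\<open>{0, 1, 2}\<close> under them are the eight transversals of the pairs \<open>{i, i + 3}\<close>, so they represent the classes of
permutations that contribute to a wedge product with \<open>Upsilon0\<close>.
\<close>

definition pair_swap :: "bool \<Rightarrow> bool \<Rightarrow> bool \<Rightarrow> nat \<Rightarrow> nat" where
  "pair_swap x y z = (if x then Transposition.transpose 0 3 else id) \<circ>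
     (if y then Transposition.transpose 1 4 else id) \<circ> (if z then Transposition.transpose 2 5 else id)"

lemma pair_swap_nth:
  "pair_swap x y z 0 = (if x then 3 else 0)" "pair_swap x y z 1 = (if y then 4 else 1)"
  "pair_swap x y z 2 = (if z then 5 else 2)" "pair_swap x y z 3 = (if x then 0 else 3)"
  "pair_swap x y z 4 = (if y then 1 else 4)" "pair_swap x y z 5 = (if z then 2 else 5)"
  by (simp_all add: pair_swap_def Transposition.transpose_def)

lemma pair_swap_permutes: "pair_swap x y z permutes {..<6}"
  unfolding pair_swap_def by (intro permutes_compose) (auto intro: permutes_swap_id permutes_id)

lemma sign_pair_swap:
  "sign (pair_swap x y z) = (if x then -1 else 1) * (if y then -1 else 1) * (if z then -1 else 1)"
  unfolding pair_swap_def
  by (simp add: sign_compose permutation_swap_id permutation_compose sign_swap_id)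

lemma lessThan_3: "{..<3::nat} = {0, 1, 2}" by auto

lemma pair_swap_image: "pair_swap x y z ` {..<3} = {if x then 3 else 0, if y then 4 else 1, if z then 5 else 2}"
  unfolding lessThan_3 by (simp add: pair_swap_nth pair_swap_nth(2)[simplified])

lemma pair_swap_image_mem: "3 \<in> pair_swap x y z ` {..<3} \<longleftrightarrow> x" "4 \<in> pair_swap x y z ` {..<3} \<longleftrightarrow> y"
  "5 \<in> pair_swap x y z ` {..<3} \<longleftrightarrow> z"
  unfolding pair_swap_image by simp_all

lemma less_3_cases: "i < 3 \<longleftrightarrow> i = 0 \<or> i = 1 \<or> i = 2" for i :: nat
  by auto

text \<open>
Three elements that meet each of the pairs \<open>{i, i + 3}\<close> meet each of them exactly once, so that the set is
determined by the elements above 2.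
\<close>

lemma transversal_image_cases:
  assumes p: "p permutes {..<6}" and t: "\<And>i. i < 3 \<Longrightarrow> i \<in> p ` {..<3} \<or> i + 3 \<in> p ` {..<3}"
  shows "p ` {..<3} = pair_swap x y z ` {..<3} \<longleftrightarrow> (x, y, z) = (3 \<in> p ` {..<3}, 4 \<in> p ` {..<3}, 5 \<in> p ` {..<3})"
proof -
  let ?A = "p ` {..<3}"
  have card: "card ?A = 3" using card_image[OF inj_on_subset[OF permutes_inj[OF p]]] by simp
  define x' y' z' where "x' = (3 \<in> ?A)" and "y' = (4 \<in> ?A)" and "z' = (5 \<in> ?A)"
  have sub: "pair_swap x' y' z' ` {..<3} \<subseteq> ?A"
    using t[of 0] t[of 1] t[of 2] by (auto simp: pair_swap_image x'_def y'_def z'_def)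
  have "card (pair_swap x' y' z' ` {..<3}) = 3"
    using card_image[OF inj_on_subset[OF permutes_inj[OF pair_swap_permutes]]] by simp
  then have "pair_swap x' y' z' ` {..<3} = ?A"
    by (intro card_subset_eq sub) (use card in auto)
  then have conv: "?A = pair_swap x y z ` {..<3}" if "(x, y, z) = (x', y', z')"
    using that by simp
  have "(x, y, z) = (x', y', z')" if "?A = pair_swap x y z ` {..<3}"
    unfolding x'_def y'_def z'_def that pair_swap_image_mem ..
  with conv show ?thesis unfolding x'_def y'_def z'_def by blast
qed

text \<open>
Assume that \<open>\<beta>\<close> vanishes as soon as both \<open>v i\<close> and \<open>v (i + 3)\<close> are among its arguments. Then only the
permutations that send a transversal to the first factor contribute, and grouping them by this transversal
leaves eight summands, each with the same multiplicity.
\<close>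

lemma wedge_3_3_sum_over_transversals:
  assumes a: "alt_form 3 \<alpha>" and b: "alt_form 3 \<beta>"
    and van: "\<And>p i. p permutes {..<6} \<Longrightarrow> i < 3 \<Longrightarrow> i \<notin> p ` {..<3} \<Longrightarrow> i + 3 \<notin> p ` {..<3} \<Longrightarrow>
        \<beta> (\<lambda>j. v (p (3 + j))) = 0"
    and zero: "wedge 3 3 \<alpha> \<beta> v = 0"
  shows "(\<Sum>(x, y, z)\<in>UNIV. wedge_term 3 3 \<alpha> \<beta> v (pair_swap x y z)) = 0"
proof -
  define S where "S = {p. p permutes {..<6::nat}}"
  define G where "G = {p\<in>S. \<forall>i<3. i \<in> p ` {..<3} \<or> i + 3 \<in> p ` {..<3}}"
  let ?t = "wedge_term 3 3 \<alpha> \<beta> v"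
  let ?g = "\<lambda>p. (3 \<in> p ` {..<3}, 4 \<in> p ` {..<3}, 5 \<in> p ` {..<3::nat})"
  define N where "N = card {p. p permutes {..<6::nat} \<and> p ` {..<3} = {..<3}}"
  have fin: "finite S" unfolding S_def by (simp add: finite_permutations)
  then have finG: "finite G" unfolding G_def by simp
  have "id \<in> {p. p permutes {..<6::nat} \<and> p ` {..<3} = {..<3}}" by (simp add: permutes_id)
  moreover have "finite {p. p permutes {..<6::nat} \<and> p ` {..<3} = {..<3}}"
    using fin unfolding S_def by (rule rev_finite_subset) auto
  ultimately have N: "N \<noteq> 0" unfolding N_def by (metis card_0_eq empty_iff)
  have cls: "(\<Sum>p | p \<in> G \<and> ?g p = (x, y, z). ?t p) = N * ?t (pair_swap x y z)" for x y z
  proof -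
    have img_swap: "i \<in> pair_swap x y z ` {..<3} \<or> i + 3 \<in> pair_swap x y z ` {..<3}" if "i < 3" for i
      using that unfolding pair_swap_image by (auto simp: less_3_cases)
    have "{p \<in> G. ?g p = (x, y, z)} = {p. p permutes {..<3+3} \<and> p ` {..<3} = pair_swap x y z ` {..<3}}"
      (is "?L = ?R")
    proof (intro set_eqI iffI)
      fix p assume "p \<in> ?L"
      then show "p \<in> ?R" using transversal_image_cases[of p x y z] by (auto simp: G_def S_def)
    next
      fix p assume *: "p \<in> ?R"
      then have t: "\<And>i. i < 3 \<Longrightarrow> i \<in> p ` {..<3} \<or> i + 3 \<in> p ` {..<3}" using img_swap by simp
      with * show "p \<in> ?L" using transversal_image_cases[of p x y z] by (auto simp: G_def S_def)
    qed
    moreover have "?t p = ?t (pair_swap x y z)" if "p \<in> ?R" for p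
      using that pair_swap_permutes by (intro wedge_term_const_on_class[OF a b]) auto
    moreover have "card {p. p permutes {..<3+3} \<and> p ` {..<3} = pair_swap x y z ` {..<3}} = N"
      unfolding N_def using card_permutation_class[of "pair_swap x y z" 3 3] pair_swap_permutes by simp
    ultimately show ?thesis by simp
  qed
  have "N * (\<Sum>(x, y, z)\<in>UNIV. ?t (pair_swap x y z)) = (\<Sum>u\<in>UNIV. \<Sum>p | p \<in> G \<and> ?g p = u. ?t p)"
    unfolding sum_distrib_left
  proof (rule sum.cong)
    fix u :: "bool \<times> bool \<times> bool"
    show "N * (case u of (x, y, z) \<Rightarrow> ?t (pair_swap x y z)) = (\<Sum>p | p \<in> G \<and> ?g p = u. ?t p)"
      using cls[of "fst u" "fst (snd u)" "snd (snd u)"] by (simp add: case_prod_unfold)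
  qed simp
  also have "\<dots> = sum ?t G" by (rule sum.group[OF finG]) auto
  also have "\<dots> = sum ?t S"
    using van by (intro sum.mono_neutral_left[OF fin]) (auto simp: G_def S_def wedge_term_def)
  also have "\<dots> = 0"
    using zero unfolding wedge_def S_def wedge_term_def by simp
  finally show ?thesis using N by simp
qed

lemma alt_form_pull:
  assumes "linear u" "alt_form k \<alpha>" shows "alt_form k (pull u \<alpha>)"
proof -
  have "linear (\<lambda>x. \<alpha> (\<lambda>j. u ((v(i := x)) j)))" if "i < k" for v i
  proof -
    have "(\<lambda>j. u ((v(i := x)) j)) = (\<lambda>j. u (v j))(i := u x)" for x by auto
    moreover have "linear (\<lambda>x. \<alpha> ((\<lambda>j. u (v j))(i := x)))"
      using assms(2) that unfolding alt_form_def by blast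
    ultimately show ?thesis using linear_compose[OF assms(1)] by (simp add: comp_def)
  qed
  moreover have "\<alpha> (\<lambda>j. u (v j)) = \<alpha> (\<lambda>j. u (w j))" if "\<forall>i<k. v i = w i" for v w
    using assms(2) that by (intro alt_form_cong[OF assms(2)]) auto
  moreover have "\<alpha> (\<lambda>j. u (v j)) = 0" if "i < k" "j < k" "i \<noteq> j" "v i = v j" for v i j
    using assms(2) that unfolding alt_form_def by (metis (no_types, lifting))
  ultimately show ?thesis unfolding alt_form_def pull_def by blast
qed

lemma J0_nth [simp]:
  "J0 v $ 1 = - v $ 4" "J0 v $ 2 = - v $ 5" "J0 v $ 3 = - v $ 6"
  "J0 v $ 4 = v $ 1" "J0 v $ 5 = v $ 2" "J0 v $ 6 = v $ 3"
  by (simp_all add: J0_def basis_vec_def axis_def)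

lemma basis_vec_nth: "basis_vec i $ j = (if j = i then 1 else 0)"
  by (simp add: basis_vec_def axis_def)

lemma J0_basis: "J0 (basis_vec 1) = basis_vec 4" "J0 (basis_vec 2) = basis_vec 5" "J0 (basis_vec 3) = basis_vec 6"
  by (simp_all add: vec6_eq_iff basis_vec_nth)

text \<open>
The standard basis, numbered from 0 as the slots of a form are.
\<close>

definition std_basis :: "nat \<Rightarrow> real^6" where "std_basis n = basis_vec (of_nat (Suc n))"

lemma std_basis_nth: "std_basis 0 = basis_vec 1" "std_basis 1 = basis_vec 2" "std_basis 2 = basis_vec 3"
  "std_basis 3 = basis_vec 4" "std_basis 4 = basis_vec 5" "std_basis 5 = basis_vec 6"
  by (simp_all add: std_basis_def)

lemma cplx_coords_simps:
  "cplx_coords x $ 1 = Complex (x$1) (x$4)" "cplx_coords x $ 2 = Complex (x$2) (x$5)"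
  "cplx_coords x $ 3 = Complex (x$3) (x$6)"
  by (simp_all add: cplx_coords_def)

lemma Upsilon0_expand:
  "Upsilon0 v = (let a = cplx_coords (v 0); b = cplx_coords (v 1); c = cplx_coords (v 2) in
     a$1 * b$2 * c$3 + a$2 * b$3 * c$1 + a$3 * b$1 * c$2 - a$1 * b$3 * c$2 - a$2 * b$1 * c$3 - a$3 * b$2 * c$1)"
  by (simp add: Upsilon0_eq_det det_3 Let_def)

lemma cplx_coords_linear: "cplx_coords (x + y) = cplx_coords x + cplx_coords y"
   "cplx_coords (c *\<^sub>R x) = c *\<^sub>R cplx_coords x"
  by (simp_all add: vec_eq_iff forall_3 cplx_coords_simps complex_eq_iff)

lemma cplx_coords_J0: "cplx_coords (J0 x) $ k = \<i> * cplx_coords x $ k"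
  using exhaust_3[of k] by (auto simp: cplx_coords_simps complex_eq_iff)

lemma alt_form_Upsilon0: "alt_form 3 Upsilon0"
proof -
  have "linear (\<lambda>x. Upsilon0 (v(i := x)))" if "i < 3" for v i
    using that 
    by (intro linearI; auto simp: less_3_cases Upsilon0_expand Let_def cplx_coords_linear algebra_simps)
  moreover have "Upsilon0 v = 0" if "i < 3" "j < 3" "i \<noteq> j" "v i = v j" for v i j
    using that by (auto simp: less_3_cases Upsilon0_expand Let_def algebra_simps)
  moreover have "Upsilon0 v = Upsilon0 w" if "\<forall>i<3. v i = w i" for v w
    using that by (auto simp: Upsilon0_eq_det)
  ultimately show ?thesis unfolding alt_form_def by blast
qed

text \<open>
\<open>Upsilon0\<close> is complex linear, and \<open>J0 x\<close> is the multiple \<open>\<i> x\<close> of \<open>x\<close>.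
\<close>

lemma Upsilon0_eq_0_J0:
  assumes "a < 3" "b < 3" "a \<noteq> b" "v b = J0 (v a)"
  shows "Upsilon0 v = 0"
  using assms by (auto simp: less_3_cases Upsilon0_expand Let_def cplx_coords_J0 algebra_simps)

lemma alt_form_Re: "alt_form k \<alpha> \<Longrightarrow> alt_form k (Re_form \<alpha>)"
  and alt_form_Im: "alt_form k \<alpha> \<Longrightarrow> alt_form k (Im_form \<alpha>)"
  unfolding alt_form_def Re_form_def Im_form_def
  by (auto intro!: linear_compose[where g = Re, unfolded comp_def] linear_compose[where g = Im, unfolded comp_def]
    bounded_linear.linear[OF bounded_linear_Re] bounded_linear.linear[OF bounded_linear_Im]) metis+

lemma Upsilon0_std_basis_vanish:
  assumes p: "p permutes {..<6}" and i: "i < 3" "i \<notin> p ` {..<3}" "i + 3 \<notin> p ` {..<3}"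
  shows "Upsilon0 (\<lambda>j. std_basis (p (3 + j))) = 0"
proof -
  have *: "\<exists>a<3. p (3 + a) = m" if "m < 6" "m \<notin> p ` {..<3}" for m
  proof -
    obtain n where n: "m = p n" "n < 6" using permutes_image[OF p] \<open>m < 6\<close> by (metis imageE lessThan_iff)
    with that have "n \<ge> 3" by (metis imageI lessThan_iff not_le)
    with n show ?thesis by (intro exI[of _ "n - 3"]) auto
  qed
  obtain a b where ab: "a < 3" "p (3 + a) = i" "b < 3" "p (3 + b) = i + 3"
    using *[of i] *[of "i + 3"] i by auto
  have "std_basis (i + 3) = J0 (std_basis i)"
    using i(1) by (auto simp: less_3_cases std_basis_def J0_basis)
  then show ?thesis using ab by (intro Upsilon0_eq_0_J0[of a b]) auto
qed

lemma wedge_term_pair_swap: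
  assumes a: "alt_form 3 \<alpha>" and b: "alt_form 3 \<beta>"
  shows "wedge_term 3 3 \<alpha> \<beta> std_basis (pair_swap x y z) =
    (if x then -1 else 1) * (if y then -1 else 1) * (if z then -1 else 1) *
    \<alpha> (vec3 (basis_vec (if x then 4 else 1)) (basis_vec (if y then 5 else 2)) (basis_vec (if z then 6 else 3))) *
    \<beta> (vec3 (basis_vec (if x then 1 else 4)) (basis_vec (if y then 2 else 5)) (basis_vec (if z then 3 else 6)))"
  unfolding wedge_term_def sign_pair_swap alt_form_vec3[OF a, of "\<lambda>i. std_basis (pair_swap x y z i)"]
    alt_form_vec3[OF b, of "\<lambda>i. std_basis (pair_swap x y z (3 + i))"]
  by (simp add: pair_swap_nth pair_swap_nth(2)[simplified] std_basis_nth std_basis_nth(2)[simplified])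

lemma sum_bool_triples: "(\<Sum>(x, y, z)\<in>(UNIV::(bool\<times>bool\<times>bool) set). h x y z) = 
  h True True True + h True True False + h True False True + h True False False +
  h False True True + h False True False + h False False True + h False False False"
  for h :: "bool \<Rightarrow> bool \<Rightarrow> bool \<Rightarrow> real"
  by (simp add: UNIV_Times_UNIV[symmetric] sum.cartesian_product[symmetric] UNIV_bool del: UNIV_Times_UNIV)

text \<open>
These are the coefficients of \<open>\<gamma> \<and> Re \<Upsilon>\<close> and \<open>\<gamma> \<and> Im \<Upsilon>\<close>, up to sign. The real part of \<open>Upsilon0\<close> only sees basis
triples with an even number of indices above 3, and the imaginary part only those with an odd number; so each
of the two sums over transversals has four terms.
\<close>

lemma Lambda3_12_component_relations:
  assumes a: "alt_form 3 \<gamma>" 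
    and re: "wedge 3 3 \<gamma> (Re_form Upsilon0) = (\<lambda>v. 0)" and im: "wedge 3 3 \<gamma> (Im_form Upsilon0) = (\<lambda>v. 0)"
  defines "e \<equiv> \<lambda>i j k. \<gamma> (vec3 (basis_vec i) (basis_vec j) (basis_vec k))"
  shows "e 4 2 3 + e 1 5 3 + e 1 2 6 = e 4 5 6" "e 1 5 6 + e 4 2 6 + e 4 5 3 = e 1 2 3"
proof -
  have "(\<Sum>(x, y, z)\<in>UNIV. wedge_term 3 3 \<gamma> (Re_form Upsilon0) std_basis (pair_swap x y z)) = 0"
    by (rule wedge_3_3_sum_over_transversals[OF a alt_form_Re[OF alt_form_Upsilon0]])
      (simp_all add: re, simp add: Re_form_def Upsilon0_std_basis_vanish)
  then show "e 4 2 3 + e 1 5 3 + e 1 2 6 = e 4 5 6"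
    unfolding sum_bool_triples wedge_term_pair_swap[OF a alt_form_Re[OF alt_form_Upsilon0]] e_def
    by (simp add: Re_form_def Upsilon0_expand cplx_coords_simps basis_vec_nth)
  have "(\<Sum>(x, y, z)\<in>UNIV. wedge_term 3 3 \<gamma> (Im_form Upsilon0) std_basis (pair_swap x y z)) = 0"
    by (rule wedge_3_3_sum_over_transversals[OF a alt_form_Im[OF alt_form_Upsilon0]])
      (simp_all add: im, simp add: Im_form_def Upsilon0_std_basis_vanish)
  then show "e 1 5 6 + e 4 2 6 + e 4 5 3 = e 1 2 3"
    unfolding sum_bool_triples wedge_term_pair_swap[OF a alt_form_Im[OF alt_form_Upsilon0]] e_def
    by (simp add: Im_form_def Upsilon0_expand cplx_coords_simps basis_vec_nth)
qed

section \<open>Naturality of the exterior derivative of a 2-form\<close>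

text \<open>
The mean value theorem, first for the difference of \<open>\<phi>\<close> along the two sides in direction \<open>a\<close>, then for the
derivative of \<open>\<phi>\<close> in that direction, along \<open>b\<close>.
\<close>

lemma second_difference_mvt:
  fixes \<phi> :: "'a::real_normed_vector \<Rightarrow> real"
  assumes h: "0 < h"
    and sub: "\<And>s t. 0 \<le> s \<Longrightarrow> s \<le> h \<Longrightarrow> 0 \<le> t \<Longrightarrow> t \<le> h \<Longrightarrow> x + s *\<^sub>R a + t *\<^sub>R b \<in> S"
    and d1: "\<And>y. y \<in> S \<Longrightarrow> \<phi> differentiable at y"
    and d2: "\<And>y. y \<in> S \<Longrightarrow> (\<lambda>y. frechet_derivative \<phi> (at y) a) differentiable at y"
  obtains s t where "0 < s" "s < h" "0 < t" "t < h"
    "\<phi> (x + h *\<^sub>R a + h *\<^sub>R b) - \<phi> (x + h *\<^sub>R a) - \<phi> (x + h *\<^sub>R b) + \<phi> x =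
       h * h * frechet_derivative (\<lambda>y. frechet_derivative \<phi> (at y) a) (at (x + s *\<^sub>R a + t *\<^sub>R b)) b"
proof -
  let ?D = "\<lambda>y. frechet_derivative \<phi> (at y) a"
  have der1: "((\<lambda>s. \<phi> (x + s *\<^sub>R a + t *\<^sub>R b)) has_real_derivative ?D (x + s *\<^sub>R a + t *\<^sub>R b)) (at s)"
    if "0 \<le> s" "s \<le> h" "0 \<le> t" "t \<le> h" for s t
  proof -
    have phi: "(\<phi> has_derivative frechet_derivative \<phi> (at (x + s *\<^sub>R a + t *\<^sub>R b))) (at (x + s *\<^sub>R a + t *\<^sub>R b))"
      using d1[OF sub[OF that]] by (simp add: frechet_derivative_works)
    have "((\<lambda>s. x + s *\<^sub>R a + t *\<^sub>R b) has_derivative (\<lambda>r. r *\<^sub>R a)) (at s)"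
      by (auto intro!: derivative_eq_intros)
    from has_derivative_compose[OF this phi]
    show ?thesis
      unfolding has_field_derivative_def
      by (rule has_derivative_eq_rhs) (simp add: fun_eq_iff linear_cmul[OF has_derivative_linear[OF phi]])
  qed
  have der2: "((\<lambda>t. ?D (x + s *\<^sub>R a + t *\<^sub>R b)) has_real_derivative
      frechet_derivative ?D (at (x + s *\<^sub>R a + t *\<^sub>R b)) b) (at t)"
    if "0 \<le> s" "s \<le> h" "0 \<le> t" "t \<le> h" for s t
  proof -
    have phi: "(?D has_derivative frechet_derivative ?D (at (x + s *\<^sub>R a + t *\<^sub>R b))) (at (x + s *\<^sub>R a + t *\<^sub>R b))"
      using d2[OF sub[OF that]] by (simp add: frechet_derivative_works)
    have "((\<lambda>t. x + s *\<^sub>R a + t *\<^sub>R b) has_derivative (\<lambda>r. r *\<^sub>R b)) (at t)"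
      by (auto intro!: derivative_eq_intros)
    from has_derivative_compose[OF this phi]
    show ?thesis
      unfolding has_field_derivative_def
      by (rule has_derivative_eq_rhs) (simp add: fun_eq_iff linear_cmul[OF has_derivative_linear[OF phi]])
  qed
  let ?\<psi> = "\<lambda>s. \<phi> (x + s *\<^sub>R a + h *\<^sub>R b) - \<phi> (x + s *\<^sub>R a + 0 *\<^sub>R b)"
  have "\<exists>s. 0 < s \<and> s < h \<and> ?\<psi> h - ?\<psi> 0 = (h - 0) * (?D (x + s *\<^sub>R a + h *\<^sub>R b) - ?D (x + s *\<^sub>R a + 0 *\<^sub>R b))"
    using h by (intro MVT2 DERIV_diff der1) auto
  then obtain s where s: "0 < s" "s < h"
    "?\<psi> h - ?\<psi> 0 = h * (?D (x + s *\<^sub>R a + h *\<^sub>R b) - ?D (x + s *\<^sub>R a + 0 *\<^sub>R b))" by auto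
  have "\<exists>t. 0 < t \<and> t < h \<and> ?D (x + s *\<^sub>R a + h *\<^sub>R b) - ?D (x + s *\<^sub>R a + 0 *\<^sub>R b) =
      (h - 0) * frechet_derivative ?D (at (x + s *\<^sub>R a + t *\<^sub>R b)) b"
    using h s by (intro MVT2 der2) auto
  then obtain t where "0 < t" "t < h"  "?D (x + s *\<^sub>R a + h *\<^sub>R b) - ?D (x + s *\<^sub>R a + 0 *\<^sub>R b) =
      h * frechet_derivative ?D (at (x + s *\<^sub>R a + t *\<^sub>R b)) b" by auto
  with s that show thesis by (simp add: algebra_simps)
qed

text \<open>
The second difference over a parallelogram is symmetric in its two sides. By the mean value theorem it is
represented by either mixed derivative at some nearby points, and both are continuous.
\<close>

lemma mixed_partials_commute:
  fixes \<phi> :: "'a::real_normed_vector \<Rightarrow> real"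
  assumes S: "open S" "x \<in> S" and C2: "Ck_on 2 S \<phi>"
  shows "frechet_derivative (\<lambda>y. frechet_derivative \<phi> (at y) a) (at x) b =
         frechet_derivative (\<lambda>y. frechet_derivative \<phi> (at y) b) (at x) a"
proof -
  let ?D = "\<lambda>a b y. frechet_derivative (\<lambda>y. frechet_derivative \<phi> (at y) a) (at y) b"
  have C2': "Ck_on (Suc (Suc 0)) S \<phi>" using C2 by (simp add: numeral_2_eq_2)
  then have d1: "\<And>y. y \<in> S \<Longrightarrow> \<phi> differentiable at y"
    and d2: "\<And>y a. y \<in> S \<Longrightarrow> (\<lambda>y. frechet_derivative \<phi> (at y) a) differentiable at y"
    and cont: "\<And>a b. continuous_on S (?D a b)" by auto
  have near: "\<exists>y1 y2. dist y1 x < e \<and> dist y2 x < e \<and> ?D a b y1 = ?D b a y2" if e: "e > 0" "ball x e \<subseteq> S" for e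
  proof -
    \<comment> \<open>Small enough for the whole parallelogram with sides \<open>h a\<close> and \<open>h b\<close> to lie in the ball;
      the 1 keeps the denominator positive when \<open>a = b = 0\<close>.\<close>
    define h where "h = e / (2 * (norm a + norm b + 1))"
    have pos: "norm a + norm b + 1 > 0" by (smt (verit) norm_ge_zero)
    have h: "h > 0" unfolding h_def using e pos by simp
    have "h * N = e / 2" if "N = norm a + norm b + 1" for N using pos that unfolding h_def that[symmetric] by simp
    then have hb: "h * (norm a + norm b + 1) < e" using e(1) by simp
    have d: "dist (x + s *\<^sub>R a + t *\<^sub>R b) x < e" if "0 \<le> s" "s \<le> h" "0 \<le> t" "t \<le> h" for s t
    proof -
      have "dist (x + s *\<^sub>R a + t *\<^sub>R b) x = norm (s *\<^sub>R a + t *\<^sub>R b)" by (simp add: dist_norm algebra_simps)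
      also have "\<dots> \<le> s * norm a + t * norm b"
        using norm_triangle_ineq[of "s *\<^sub>R a" "t *\<^sub>R b"] that by simp
      also have "\<dots> \<le> h * norm a + h * norm b" using that by (intro add_mono mult_right_mono) auto
      also have "\<dots> < e" using hb h by (simp add: algebra_simps)
      finally show ?thesis .
    qed
    have inS: "x + s *\<^sub>R a + t *\<^sub>R b \<in> S" if "0 \<le> s" "s \<le> h" "0 \<le> t" "t \<le> h" for s t
      using d[OF that] e by (auto simp: dist_commute)
    then have inS': "x + t *\<^sub>R b + s *\<^sub>R a \<in> S" if "0 \<le> s" "s \<le> h" "0 \<le> t" "t \<le> h" for s t
      using that by (simp add: add.commute add.left_commute)
    obtain s t where 1: "0 < s" "s < h" "0 < t" "t < h"
      "\<phi> (x + h *\<^sub>R a + h *\<^sub>R b) - \<phi> (x + h *\<^sub>R a) - \<phi> (x + h *\<^sub>R b) + \<phi> x = h * h * ?D a b (x + s *\<^sub>R a + t *\<^sub>R b)"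
      by (rule second_difference_mvt[OF h inS d1 d2])
    obtain t' s' where 2: "0 < t'" "t' < h" "0 < s'" "s' < h" 
      "\<phi> (x + h *\<^sub>R b + h *\<^sub>R a) - \<phi> (x + h *\<^sub>R b) - \<phi> (x + h *\<^sub>R a) + \<phi> x = h * h * ?D b a (x + t' *\<^sub>R b + s' *\<^sub>R a)"
      by (rule second_difference_mvt[OF h inS' d1 d2])
    have eqs: "x + h *\<^sub>R b + h *\<^sub>R a = x + h *\<^sub>R a + h *\<^sub>R b" "x + t' *\<^sub>R b + s' *\<^sub>R a = x + s' *\<^sub>R a + t' *\<^sub>R b"
      by (simp_all add: add.commute add.left_commute)
    have "h * h * ?D a b (x + s *\<^sub>R a + t *\<^sub>R b) = h * h * ?D b a (x + s' *\<^sub>R a + t' *\<^sub>R b)"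
      using 1(5) 2(5)[unfolded eqs] by linarith
    then have "?D a b (x + s *\<^sub>R a + t *\<^sub>R b) = ?D b a (x + s' *\<^sub>R a + t' *\<^sub>R b)" using h by simp
    then show ?thesis using d[of s t] d[of s' t'] 1 2 less_imp_le by metis
  qed
  obtain r where r: "r > 0" "ball x r \<subseteq> S" using S open_contains_ball by blast
  show ?thesis
  proof (rule ccontr)
    assume ne: "?D a b x \<noteq> ?D b a x"
    define \<epsilon> where "\<epsilon> = dist (?D a b x) (?D b a x) / 2"
    have eps: "\<epsilon> > 0" using ne by (simp add: \<epsilon>_def)
    obtain r1 where r1: "r1 > 0" "\<And>y. dist y x < r1 \<Longrightarrow> y \<in> S \<Longrightarrow> dist (?D a b y) (?D a b x) < \<epsilon>"
      using cont[of a b] S(2) eps unfolding continuous_on_iff by blast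
    obtain r2 where r2: "r2 > 0" "\<And>y. dist y x < r2 \<Longrightarrow> y \<in> S \<Longrightarrow> dist (?D b a y) (?D b a x) < \<epsilon>"
      using cont[of b a] S(2) eps unfolding continuous_on_iff by blast
    let ?e = "min r (min r1 r2)"
    have "?e > 0" "ball x ?e \<subseteq> S" using r r1(1) r2(1) by auto
    from near[OF this] obtain y1 y2 where y: "dist y1 x < ?e" "dist y2 x < ?e" "?D a b y1 = ?D b a y2" by blast
    have "y1 \<in> S" "y2 \<in> S" using y \<open>ball x ?e \<subseteq> S\<close> by (auto simp: dist_commute subset_iff)
    then have "dist (?D a b y1) (?D a b x) < \<epsilon>" "dist (?D b a y2) (?D b a x) < \<epsilon>" using r1(2)[of y1] r2(2)[of y2] y(1,2) by simp_all
    then show False using dist_triangle3[of "?D a b x" "?D b a x" "?D a b y1"] unfolding y(3) \<epsilon>_def by linarith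
  qed
qed

lemma frechet_derivative_cong_open:
  assumes "open S" "x \<in> S" "\<And>y. y \<in> S \<Longrightarrow> f y = g y"
  shows "frechet_derivative f (at x) = frechet_derivative g (at x)"
proof -
  have "(f has_derivative D) (at x) \<longleftrightarrow> (g has_derivative D) (at x)" for D
    using has_derivative_transform_within_open[of f D x UNIV S g] 
      has_derivative_transform_within_open[of g D x UNIV S f] assms by auto
  then show ?thesis unfolding frechet_derivative_def by simp
qed

lemma Ck_on_cong:
  assumes "open S" "\<And>y. y \<in> S \<Longrightarrow> f y = g y"
  shows "Ck_on n S f \<longleftrightarrow> Ck_on n S g"
  using assms(2)
proof (induction n arbitrary: f g)
  case 0
  then show ?case by (simp cong: continuous_on_cong)
next
  case (Suc n)
  have "f differentiable at x \<longleftrightarrow> g differentiable at x" if "x \<in> S" for x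
    using has_derivative_transform_within_open[of f _ x UNIV S g]
      has_derivative_transform_within_open[of g _ x UNIV S f] that Suc.prems assms(1)
    unfolding differentiable_def by auto
  moreover have "frechet_derivative f (at x) = frechet_derivative g (at x)" if "x \<in> S" for x
    by (rule frechet_derivative_cong_open[OF assms(1) that Suc.prems])
  then have "Ck_on n S (\<lambda>x. frechet_derivative f (at x) v) = Ck_on n S (\<lambda>x. frechet_derivative g (at x) v)" for v
    by (intro Suc.IH) simp
  ultimately show ?case by simp
qed

lemma frechet_derivative_inner_right:
  assumes "f differentiable at x"
  shows "frechet_derivative (\<lambda>y. f y \<bullet> k) (at x) = (\<lambda>v. frechet_derivative f (at x) v \<bullet> k)"
proof -
  have "((\<lambda>y. f y \<bullet> k) has_derivative (\<lambda>v. frechet_derivative f (at x) v \<bullet> k)) (at x)"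
    using assms unfolding frechet_derivative_works by (rule has_derivative_inner_left)
  then show ?thesis by (rule frechet_derivative_at[symmetric])
qed

lemma Ck_on_inner:
  fixes f :: "'a::real_normed_vector \<Rightarrow> 'b::real_inner"
  assumes "open S"
  shows "Ck_on n S f \<Longrightarrow> Ck_on n S (\<lambda>y. f y \<bullet> k)"
proof (induction n arbitrary: f)
  case 0
  then show ?case by (simp add: continuous_on_inner)
next
  case (Suc n)
  then have d: "\<And>x. x \<in> S \<Longrightarrow> f differentiable at x" by simp
  have "Ck_on n S (\<lambda>x. frechet_derivative (\<lambda>y. f y \<bullet> k) (at x) v)" for v
  proof -
    have "Ck_on n S (\<lambda>x. frechet_derivative f (at x) v \<bullet> k)" using Suc by simp
    then show ?thesis
      by (rule Ck_on_cong[OF assms, THEN iffD1, rotated]) (simp add: frechet_derivative_inner_right d)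
  qed
  moreover have "(\<lambda>y. f y \<bullet> k) differentiable at x" if "x \<in> S" for x
    using d[OF that] has_derivative_inner_left unfolding differentiable_def by blast
  ultimately show ?case by simp
qed

lemma second_derivative_symmetric:
  fixes F :: "'a::real_normed_vector \<Rightarrow> 'b::euclidean_space"
  assumes S: "open S" "x \<in> S" and C2: "Ck_on 2 S F"
  shows "frechet_derivative (\<lambda>y. frechet_derivative F (at y) a) (at x) b =
         frechet_derivative (\<lambda>y. frechet_derivative F (at y) b) (at x) a"
proof (rule euclidean_eqI)
  fix k :: 'b
  have C2': "Ck_on (Suc (Suc 0)) S F" using C2 by (simp add: numeral_2_eq_2)
  have comp: "frechet_derivative (\<lambda>y. frechet_derivative (\<lambda>y. F y \<bullet> k) (at y) a) (at x) b =
      frechet_derivative (\<lambda>y. frechet_derivative F (at y) a) (at x) b \<bullet> k" for a b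
  proof -
    have "frechet_derivative (\<lambda>y. frechet_derivative (\<lambda>y. F y \<bullet> k) (at y) a) (at x) =
       frechet_derivative (\<lambda>y. frechet_derivative F (at y) a \<bullet> k) (at x)"
      by (rule frechet_derivative_cong_open[OF S]) (use C2' in \<open>simp add: frechet_derivative_inner_right\<close>)
    also have "\<dots> = (\<lambda>b. frechet_derivative (\<lambda>y. frechet_derivative F (at y) a) (at x) b \<bullet> k)"
      by (rule frechet_derivative_inner_right) (use C2' S in simp)
    finally show ?thesis by simp
  qed
  show "frechet_derivative (\<lambda>y. frechet_derivative F (at y) a) (at x) b \<bullet> k =
         frechet_derivative (\<lambda>y. frechet_derivative F (at y) b) (at x) a \<bullet> k"
    using mixed_partials_commute[OF S Ck_on_inner[OF S(1) C2, of k], of a b] unfolding comp .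
qed

text \<open>
Arguments of a 2-form; a form takes an infinite sequence, of which it reads the first two entries.
\<close>

definition pair_seq :: "'v \<Rightarrow> 'v \<Rightarrow> nat \<Rightarrow> 'v" where
  "pair_seq p q = (\<lambda>i. if i = 0 then p else q)"

lemma alt_form_2_linear:
  assumes "alt_form 2 \<alpha>"
  shows "linear (\<lambda>p. \<alpha> (pair_seq p q))" "linear (\<lambda>q. \<alpha> (pair_seq p q))"
proof -
  have lin: "linear (\<lambda>x. \<alpha> ((pair_seq p q)(i := x)))" if "i < 2" for p q i
    using assms that unfolding alt_form_def by blast
  have "\<alpha> ((pair_seq p q)(0 := x)) = \<alpha> (pair_seq x q)" "\<alpha> ((pair_seq p q)(1 := x)) = \<alpha> (pair_seq p x)" for p q x
    by (rule alt_form_cong[OF assms]; auto simp: pair_seq_def)+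
  with lin[of 0] lin[of 1] show "linear (\<lambda>p. \<alpha> (pair_seq p q))" "linear (\<lambda>q. \<alpha> (pair_seq p q))" by simp_all
qed

lemma alt_form_2_antisym:
  assumes "alt_form 2 \<alpha>"
  shows "\<alpha> (pair_seq p q) = - \<alpha> (pair_seq q p)"
proof -
  have "\<alpha> (pair_seq p q) = \<alpha> (\<lambda>m. pair_seq q p (Transposition.transpose 0 1 m))"
    by (rule alt_form_cong[OF assms]) (auto simp: pair_seq_def Transposition.transpose_def)
  also have "\<dots> = - \<alpha> (pair_seq q p)" by (rule alt_form_swap[OF assms]) auto
  finally show ?thesis .
qed

lemma alt_form_2_components:
  fixes \<alpha> :: "('b::euclidean_space, real) form"
  assumes "alt_form 2 \<alpha>"
  shows "\<alpha> (pair_seq p q) = (\<Sum>k\<in>Basis. \<Sum>l\<in>Basis. \<alpha> (pair_seq k l) * (p \<bullet> k) * (q \<bullet> l))"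
proof -
  have "\<alpha> (pair_seq p q) = \<alpha> (pair_seq (\<Sum>k\<in>Basis. (p \<bullet> k) *\<^sub>R k) (\<Sum>l\<in>Basis. (q \<bullet> l) *\<^sub>R l))"
    by (simp add: euclidean_representation)
  also have "\<dots> = (\<Sum>k\<in>Basis. \<Sum>l\<in>Basis. \<alpha> (pair_seq k l) * (p \<bullet> k) * (q \<bullet> l))"
    unfolding linear_sum[OF alt_form_2_linear(1)[OF assms]] linear_sum[OF alt_form_2_linear(2)[OF assms]]
      linear_cmul[OF alt_form_2_linear(1)[OF assms]] linear_cmul[OF alt_form_2_linear(2)[OF assms]]
    by (subst sum.swap) (simp add: sum_distrib_left algebra_simps)
  finally show ?thesis .
qed

text \<open>
The product rule for \<open>\<omega>\<^bsub>G y\<^esub>(P y, Q y)\<close>: one summand for the coefficients of \<open>\<omega>\<close> and one for each argument.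
Expanding in components reduces it to real-valued products.
\<close>

lemma has_derivative_2form_composition:
  fixes \<omega> :: "'b::euclidean_space \<Rightarrow> ('b, real) form"
  assumes V: "open V" "G x \<in> V" and alt: "\<And>z. z \<in> V \<Longrightarrow> alt_form 2 (\<omega> z)"
    and diff: "\<And>v. (\<lambda>z. \<omega> z v) differentiable at (G x)"
    and U: "open U" "x \<in> U" "\<And>y. y \<in> U \<Longrightarrow> G y \<in> V"
    and G: "(G has_derivative G') (at x)" and P: "(P has_derivative P') (at x)" and Q: "(Q has_derivative Q') (at x)"
  shows "((\<lambda>y. \<omega> (G y) (pair_seq (P y) (Q y))) has_derivative
     (\<lambda>r. frechet_derivative (\<lambda>z. \<omega> z (pair_seq (P x) (Q x))) (at (G x)) (G' r)
        + \<omega> (G x) (pair_seq (P' r) (Q x)) + \<omega> (G x) (pair_seq (P x) (Q' r)))) (at x)"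
proof -
  let ?C = "\<lambda>k l. frechet_derivative (\<lambda>z. \<omega> z (pair_seq k l)) (at (G x))"
  have C: "((\<lambda>z. \<omega> z (pair_seq k l)) has_derivative ?C k l) (at (G x))" for k l
    using diff by (simp add: frechet_derivative_works)
  note CG = has_derivative_compose[OF G C]
  have "((\<lambda>z. \<Sum>k\<in>Basis. \<Sum>l\<in>Basis. \<omega> z (pair_seq k l) * (p \<bullet> k) * (q \<bullet> l)) has_derivative
      (\<lambda>w. \<Sum>k\<in>Basis. \<Sum>l\<in>Basis. ?C k l w * (p \<bullet> k) * (q \<bullet> l))) (at (G x))" for p q
    by (intro has_derivative_sum has_derivative_mult_left C)
  then have "((\<lambda>z. \<omega> z (pair_seq p q)) has_derivative
      (\<lambda>w. \<Sum>k\<in>Basis. \<Sum>l\<in>Basis. ?C k l w * (p \<bullet> k) * (q \<bullet> l))) (at (G x))" for p q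
    by (rule has_derivative_transform_within_open[OF _ V]) (simp add: alt_form_2_components[OF alt])
  then have C_eq: "?C p q = (\<lambda>w. \<Sum>k\<in>Basis. \<Sum>l\<in>Basis. ?C k l w * (p \<bullet> k) * (q \<bullet> l))" for p q
    by (rule frechet_derivative_at[symmetric])
  have "((\<lambda>y. \<Sum>k\<in>Basis. \<Sum>l\<in>Basis. \<omega> (G y) (pair_seq k l) * (P y \<bullet> k) * (Q y \<bullet> l)) has_derivative
      (\<lambda>r. \<Sum>k\<in>Basis. \<Sum>l\<in>Basis. \<omega> (G x) (pair_seq k l) * (P x \<bullet> k) * (Q' r \<bullet> l) +
         (\<omega> (G x) (pair_seq k l) * (P' r \<bullet> k) + ?C k l (G' r) * (P x \<bullet> k)) * (Q x \<bullet> l))) (at x)"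
    by (intro has_derivative_sum has_derivative_mult CG has_derivative_inner_left P Q)
  then have "((\<lambda>y. \<omega> (G y) (pair_seq (P y) (Q y))) has_derivative
      (\<lambda>r. \<Sum>k\<in>Basis. \<Sum>l\<in>Basis. \<omega> (G x) (pair_seq k l) * (P x \<bullet> k) * (Q' r \<bullet> l) +
         (\<omega> (G x) (pair_seq k l) * (P' r \<bullet> k) + ?C k l (G' r) * (P x \<bullet> k)) * (Q x \<bullet> l))) (at x)"
    by (rule has_derivative_transform_within_open[OF _ U(1,2)]) (simp add: alt_form_2_components[OF alt[OF U(3)]])
  then show ?thesis
  proof (rule has_derivative_eq_rhs, intro ext)
    fix r
    show "(\<Sum>k\<in>Basis. \<Sum>l\<in>Basis. \<omega> (G x) (pair_seq k l) * (P x \<bullet> k) * (Q' r \<bullet> l) +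
         (\<omega> (G x) (pair_seq k l) * (P' r \<bullet> k) + ?C k l (G' r) * (P x \<bullet> k)) * (Q x \<bullet> l)) =
       ?C (P x) (Q x) (G' r) + \<omega> (G x) (pair_seq (P' r) (Q x)) + \<omega> (G x) (pair_seq (P x) (Q' r))"
      unfolding C_eq[of "P x" "Q x"] alt_form_2_components[OF alt[OF V(2)], of "P' r"]
         alt_form_2_components[OF alt[OF V(2)], of "P x" "Q' r"]
      by (simp add: sum.distrib algebra_simps)
  qed
qed

text \<open>
Differentiate \<open>\<omega>\<^bsub>F y\<^esub>(DF b, DF c) = 0\<close> in the direction \<open>a\<close> and take the alternating sum over \<open>a, b, c\<close>. The
derivatives of the coefficients of \<open>\<omega>\<close> form \<open>d\<omega>(DF a, DF b, DF c)\<close>, and the terms with second derivatives of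
\<open>F\<close> cancel in pairs by symmetry.
\<close>

lemma ext_deriv_2_pullback_eq_0:
  fixes \<omega> :: "'b::euclidean_space \<Rightarrow> ('b, real) form" and F :: "'a::real_normed_vector \<Rightarrow> 'b"
  assumes V: "open V" and alt: "\<And>z. z \<in> V \<Longrightarrow> alt_form 2 (\<omega> z)"
    and diff: "\<And>v z. z \<in> V \<Longrightarrow> (\<lambda>z. \<omega> z v) differentiable at z"
    and U: "open U" "x \<in> U" "\<And>y. y \<in> U \<Longrightarrow> F y \<in> V" and C2: "Ck_on 2 U F"
    and zero: "\<And>y p q. y \<in> U \<Longrightarrow>
        \<omega> (F y) (pair_seq (frechet_derivative F (at y) p) (frechet_derivative F (at y) q)) = 0"
    and v: "\<And>i. v i \<in> range (frechet_derivative F (at x))"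
  shows "ext_deriv 2 \<omega> (F x) v = 0"
proof -
  let ?D = "\<lambda>p y. frechet_derivative F (at y) p"
  let ?B = "\<lambda>p. frechet_derivative (?D p) (at x)"
  have C2': "Ck_on (Suc (Suc 0)) U F" using C2 by (simp add: numeral_2_eq_2)
  then have dF: "(F has_derivative frechet_derivative F (at x)) (at x)"
    and dD: "(?D p has_derivative ?B p) (at x)" for p
    using U(2) by (simp_all add: frechet_derivative_works[symmetric])
  note FV = U(3)[OF U(2)]
  let ?W = "\<lambda>p q. \<omega> (F x) (pair_seq p q)"
  let ?E = "\<lambda>p q. frechet_derivative (\<lambda>z. \<omega> z (pair_seq p q)) (at (F x))"
  have key: "?E (?D p x) (?D q x) (?D r x) + ?W (?B p r) (?D q x) + ?W (?D p x) (?B q r) = 0" for p q r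
  proof -
    have h1: "((\<lambda>y. \<omega> (F y) (pair_seq (?D p y) (?D q y))) has_derivative
     (\<lambda>r. ?E (?D p x) (?D q x) (?D r x) + ?W (?B p r) (?D q x) + ?W (?D p x) (?B q r))) (at x)"
      by (rule has_derivative_2form_composition[OF V FV alt diff[OF FV] U(1,2,3) dF dD dD])
    have h2: "((\<lambda>y. \<omega> (F y) (pair_seq (?D p y) (?D q y))) has_derivative (\<lambda>r. 0)) (at x)"
      by (rule has_derivative_transform_within_open[OF has_derivative_const U(1,2)]) (simp add: zero)
    from fun_cong[OF has_derivative_unique[OF h1 h2], of r] show ?thesis by simp
  qed
  obtain a b c where abc: "v 0 = ?D a x" "v 1 = ?D b x" "v 2 = ?D c x" using v[of 0] v[of 1] v[of 2] by blast
  \<comment> \<open>With the derivative named, the next equation does not rewrite its own right-hand side.\<close>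
  define E where "E p q = ?E p q" for p q
  have seq: "frechet_derivative (\<lambda>z. \<omega> z w) (at (F x)) = E (w 0) (w 1)" for w
    unfolding E_def by (rule frechet_derivative_cong_open[OF V FV], rule alt_form_cong[OF alt])
      (auto simp: pair_seq_def less_2_cases_iff)
  have "ext_deriv 2 \<omega> (F x) v = E (v 1) (v 2) (v 0) - E (v 0) (v 2) (v 1) + E (v 0) (v 1) (v 2)"
    unfolding ext_deriv_def seq by (simp add: numeral_2_eq_2)
  also have "\<dots> = 0"
    unfolding abc E_def using key[of b c a] key[of a c b] key[of a b c]
      second_derivative_symmetric[OF U(1,2) C2, of a b] second_derivative_symmetric[OF U(1,2) C2, of a c]
      second_derivative_symmetric[OF U(1,2) C2, of b c]
      alt_form_2_antisym[OF alt[OF FV], of "?D b x"] alt_form_2_antisym[OF alt[OF FV], of "?D a x"]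
    by simp
  finally show ?thesis .
qed

section \<open>Frames of an SU(3)-structure and adapted frames\<close>

lemma inner_real6: "(x::real^6) \<bullet> y = x$1*y$1 + x$2*y$2 + x$3*y$3 + x$4*y$4 + x$5*y$5 + x$6*y$6"
  by (simp add: inner_vec_def sum_6)

lemma linear_J0: "linear J0"
  by (intro linearI; simp add: vec6_eq_iff algebra_simps)

lemma J0_J0 [simp]: "J0 (J0 x) = - x"
  by (simp add: vec6_eq_iff)

lemma Omega0_pair: "Omega0 v = - (v 0 \<bullet> J0 (v 1))"
  unfolding Omega0_eq inner_real6 by (simp del: One_nat_def)

text \<open>
The metric is determined by \<open>\<Omega>\<close> and \<open>J\<close>.
\<close>

lemma inner_eq_Omega0: "x \<bullet> y = Omega0 (pair_seq x (J0 y))"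
  unfolding Omega0_pair pair_seq_def by simp

lemma J0_inner [simp]: "J0 x \<bullet> J0 y = x \<bullet> y"
  by (simp add: inner_real6)

lemma J0_inner_left: "J0 x \<bullet> y = - (x \<bullet> J0 y)"
  by (simp add: inner_real6)

lemma inner_J0_skew: "x \<bullet> J0 y = - (y \<bullet> J0 x)"
  by (simp add: inner_real6)

lemma Upsilon0_J0: "Upsilon0 (vec3 (J0 x) y z) = \<i> * Upsilon0 (vec3 x y z)"
  by (simp add: Upsilon0_expand Let_def cplx_coords_J0 algebra_simps)

lemma Upsilon0_nondegenerate:
  assumes "\<And>y z. Upsilon0 (vec3 x y z) = Upsilon0 (vec3 x' y z)"
  shows "x = x'"
proof -
  have "Upsilon0 (vec3 x (basis_vec 2) (basis_vec 3)) = cplx_coords x $ 1"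
    "Upsilon0 (vec3 x (basis_vec 3) (basis_vec 1)) = cplx_coords x $ 2"
    "Upsilon0 (vec3 x (basis_vec 1) (basis_vec 2)) = cplx_coords x $ 3" for x
    by (simp_all add: Upsilon0_expand Let_def cplx_coords_simps basis_vec_nth complex_eq_iff)
  then have "cplx_coords x $ 1 = cplx_coords x' $ 1" "cplx_coords x $ 2 = cplx_coords x' $ 2"
    "cplx_coords x $ 3 = cplx_coords x' $ 3" using assms by metis+
  then show ?thesis by (simp add: vec6_eq_iff cplx_coords_simps)
qed

lemma comp_vec3: "(\<lambda>i. u (vec3 a b c i)) = vec3 (u a) (u b) (u c)"
  by (auto simp: vec3_def)

lemma comp_pair_seq: "(\<lambda>i. u (pair_seq a b i)) = pair_seq (u a) (u b)"
  by (auto simp: pair_seq_def)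

lemma range_pair_seq: "x \<in> E \<Longrightarrow> y \<in> E \<Longrightarrow> range (pair_seq x y) \<subseteq> E"
  by (auto simp: pair_seq_def)

lemma range_vec3: "x \<in> E \<Longrightarrow> y \<in> E \<Longrightarrow> z \<in> E \<Longrightarrow> range (vec3 x y z) \<subseteq> E"
  by (auto simp: vec3_def)

lemma su3_frameD:
  assumes "su3_frame \<Omega> \<Upsilon> u"
  shows "linear u" "bij u" "u (inv u x) = x" "inv u (u x) = x" "linear (inv u)"
    "\<Omega> v = Omega0 (\<lambda>i. u (v i))" "\<Upsilon> v = Upsilon0 (\<lambda>i. u (v i))"
proof -
  show l: "linear u" and b: "bij u" and "\<Omega> v = Omega0 (\<lambda>i. u (v i))" and "\<Upsilon> v = Upsilon0 (\<lambda>i. u (v i))"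
    using assms by (auto simp: su3_frame_def pull_def)
  show "u (inv u x) = x" "inv u (u x) = x" using b by (simp_all add: bij_is_surj surj_f_inv_f bij_is_inj)
  show "linear (inv u)" using l b
    by (metis bij_is_inj inj_linear_imp_inv_linear)
qed

text \<open>
\<open>J x\<close> is the only vector \<open>y\<close> with \<open>\<Upsilon>(y, \<cdot>, \<cdot>) = \<i> \<Upsilon>(x, \<cdot>, \<cdot>)\<close>, and this description does not refer to a frame.
\<close>

lemma frame_J_unique:
  assumes u: "su3_frame \<Omega> \<Upsilon> u" and u': "su3_frame \<Omega> \<Upsilon> u'"
  shows "inv u (J0 (u x)) = inv u' (J0 (u' x))"
proof -
  note U = su3_frameD[OF u] and U' = su3_frameD[OF u']
  have "Upsilon0 (vec3 (J0 (u x)) y z) = Upsilon0 (vec3 (u (inv u' (J0 (u' x)))) y z)" for y z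
  proof -
    have 1: "\<Upsilon> (vec3 w (inv u y) (inv u z)) = Upsilon0 (vec3 (u w) y z)" for w
      unfolding U(7) comp_vec3 U(3) ..
    have "Upsilon0 (vec3 (J0 (u x)) y z) = \<i> * \<Upsilon> (vec3 x (inv u y) (inv u z))"
      unfolding Upsilon0_J0 1 ..
    also have "\<dots> = Upsilon0 (vec3 (J0 (u' x)) (u' (inv u y)) (u' (inv u z)))"
      unfolding U'(7) comp_vec3 Upsilon0_J0 ..
    also have "\<dots> = \<Upsilon> (vec3 (inv u' (J0 (u' x))) (inv u y) (inv u z))"
      unfolding U'(7) comp_vec3 U'(3) ..
    finally show ?thesis unfolding 1 .
  qed
  then have "J0 (u x) = u (inv u' (J0 (u' x)))" by (rule Upsilon0_nondegenerate)
  then show ?thesis by (metis U(4))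
qed

lemma induced_J_frame:
  assumes u: "su3_frame \<Omega> \<Upsilon> u"
  shows "induced_J \<Omega> \<Upsilon> x = inv u (J0 (u x))"
proof -
  have "su3_frame \<Omega> \<Upsilon> (SOME u. su3_frame \<Omega> \<Upsilon> u)" using someI[of "su3_frame \<Omega> \<Upsilon>", OF u] .
  from frame_J_unique[OF this u] show ?thesis by (simp add: induced_J_def Let_def)
qed

lemma induced_g_frame:
  assumes u: "su3_frame \<Omega> \<Upsilon> u"
  shows "induced_g \<Omega> \<Upsilon> x y = u x \<bullet> u y"
proof -
  have g: "v x \<bullet> v y = \<Omega> (pair_seq x (inv v (J0 (v y))))" if v: "su3_frame \<Omega> \<Upsilon> v" for v
    unfolding inner_eq_Omega0 su3_frameD(6)[OF v] comp_pair_seq su3_frameD(3)[OF v] ..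
  have s: "su3_frame \<Omega> \<Upsilon> (SOME u. su3_frame \<Omega> \<Upsilon> u)" using someI[of "su3_frame \<Omega> \<Upsilon>", OF u] .
  show ?thesis unfolding induced_g_def Let_def g[OF s] g[OF u] frame_J_unique[OF s u] ..
qed

text \<open>
Complex scalar multiplication in the model, with \<open>\<i>\<close> acting as \<open>J0\<close>.
\<close>

definition cscale :: "complex \<Rightarrow> real^6 \<Rightarrow> real^6" where
  "cscale z x = Re z *\<^sub>R x + Im z *\<^sub>R J0 x"

lemma linear_cscale: "linear (cscale z)"
  unfolding cscale_def by (intro linear_compose_add linear_compose_scale_right linear_ident linear_J0)

lemma complex_mult_frame:
  assumes u: "su3_frame \<Omega> \<Upsilon> u"
  shows "complex_mult \<Omega> \<Upsilon> z x = inv u (cscale z (u x))"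
  using linear_add[OF su3_frameD(5)[OF u]] linear_cmul[OF su3_frameD(5)[OF u]]
  by (simp add: complex_mult_def cscale_def induced_J_frame[OF u] su3_frameD(4)[OF u])

lemma cplx_coords_cscale: "cplx_coords (cscale z x) $ k = z * cplx_coords x $ k"
  using exhaust_3[of k] by (auto simp: cplx_coords_simps complex_eq_iff cscale_def)

lemma cscale_cscale: "cscale z (cscale w x) = cscale (z * w) x"
  by (simp add: vec6_eq_iff cscale_def algebra_simps)

lemma cscale_1 [simp]: "cscale 1 x = x"
  by (simp add: cscale_def)

lemma Upsilon0_cscale: "Upsilon0 (\<lambda>i. cscale z (v i)) = z ^ 3 * Upsilon0 v"
  by (simp add: Upsilon0_expand Let_def cplx_coords_cscale power3_eq_cube algebra_simps)

lemma Omega0_cscale: "Omega0 (\<lambda>i. cscale z (v i)) = (cmod z)\<^sup>2 * Omega0 v"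
proof -
  have n: "(cmod z)\<^sup>2 = Re z * Re z + Im z * Im z" using cmod_power2[of z] by (simp only: power2_eq_square)
  show ?thesis unfolding n Omega0_eq by (simp add: cscale_def algebra_simps)
qed

lemma cplx_coords_scaleR: "cplx_coords (r *\<^sub>R x) $ k = of_real r * cplx_coords x $ k"
  using exhaust_3[of k] by (auto simp: cplx_coords_simps complex_eq_iff)

text \<open>
The metric and \<open>Omega0\<close> are the real and, up to sign, imaginary part of the Hermitian product on \<open>\<complex>\<^sup>3\<close>.
\<close>

lemma hermitian_product_cplx_coords:
  "(\<Sum>k\<in>UNIV. cplx_coords x $ k * cnj (cplx_coords y $ k)) = Complex (x \<bullet> y) (- Omega0 (pair_seq x y))"
  by (simp add: sum_3 cplx_coords_simps complex_eq_iff inner_real6 Omega0_eq pair_seq_def algebra_simps)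

text \<open>
The vectors form a unitary basis of \<open>\<complex>\<^sup>3\<close>, and the determinant of a unitary matrix has modulus 1.
\<close>

lemma Upsilon0_unit:
  assumes orth: "x \<bullet> x = 1" "y \<bullet> y = 1" "z \<bullet> z = 1" "x \<bullet> y = 0" "x \<bullet> z = 0" "y \<bullet> z = 0"
    and lag: "x \<bullet> J0 y = 0" "x \<bullet> J0 z = 0" "y \<bullet> J0 z = 0"
  shows "cmod (Upsilon0 (vec3 x y z)) = 1"
proof -
  define f :: "3 \<Rightarrow> real^6" where "f = (\<lambda>p. if p = 1 then x else if p = 2 then y else z)"
  define F :: "complex^3^3" where "F = (\<chi> p. cplx_coords (f p))"
  define H :: "complex^3^3" where "H = (\<chi> k q. cnj (F $ q $ k))"
  have Om: "Omega0 (pair_seq a b) = - (a \<bullet> J0 b)" for a b unfolding Omega0_pair pair_seq_def by simp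
  have JJ: "a \<bullet> J0 a = 0" for a by (simp add: inner_real6)
  have lag': "y \<bullet> J0 x = 0" "z \<bullet> J0 x = 0" "z \<bullet> J0 y = 0"
    using lag by (simp_all add: inner_J0_skew[of y x] inner_J0_skew[of z])
  have orth': "y \<bullet> x = 0" "z \<bullet> x = 0" "z \<bullet> y = 0" using orth by (simp_all add: inner_commute)
  have "(F ** H) $ p $ q = Complex (f p \<bullet> f q) (f p \<bullet> J0 (f q))" for p q
    unfolding matrix_matrix_mult_def H_def F_def
    by (simp add: hermitian_product_cplx_coords Om )
  moreover have "f p \<bullet> f q = (if p = q then 1 else 0)" "f p \<bullet> J0 (f q) = 0" for p q
    unfolding f_def using exhaust_3[of p] exhaust_3[of q] by (auto simp: orth orth' lag lag' JJ)
  ultimately have "(F ** H) $ p $ q = mat 1 $ p $ q" for p q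
    by (simp add: mat_def complex_eq_iff)
  then have "F ** H = mat 1" by (simp add: vec_eq_iff)
  then have "det F * det H = 1" by (metis det_mul det_I)
  moreover have "det H = cnj (det F)" by (simp add: H_def det_3)
  ultimately have "(cmod (det F))\<^sup>2 = 1" by (metis complex_norm_square of_real_eq_1_iff)
  moreover have "det F = Upsilon0 (vec3 x y z)" unfolding F_def Upsilon0_eq_det by (simp add: det_3 f_def)
  ultimately show ?thesis by (metis norm_ge_zero power2_eq_imp_eq one_power2 zero_le_one)
qed

text \<open>
The complex linear map that sends the first three standard basis vectors to \<open>a, b, c\<close>.
\<close>

definition complex_linear_ext :: "real^6 \<Rightarrow> real^6 \<Rightarrow> real^6 \<Rightarrow> real^6 \<Rightarrow> real^6" where
  "complex_linear_ext a b c x = x$1 *\<^sub>R a + x$2 *\<^sub>R b + x$3 *\<^sub>R c + x$4 *\<^sub>R J0 a + x$5 *\<^sub>R J0 b + x$6 *\<^sub>R J0 c"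

lemma complex_linear_ext_basis:
  "complex_linear_ext a b c (basis_vec 1) = a" "complex_linear_ext a b c (basis_vec 2) = b" "complex_linear_ext a b c (basis_vec 3) = c"
  by (simp_all add: complex_linear_ext_def basis_vec_nth)

lemma linear_complex_linear_ext: "linear (complex_linear_ext a b c)"
  by (intro linearI; simp add: complex_linear_ext_def algebra_simps scaleR_add_right)

lemma complex_linear_ext_J0: "complex_linear_ext a b c (J0 x) = J0 (complex_linear_ext a b c x)"
  by (simp add: complex_linear_ext_def linear_add[OF linear_J0] linear_cmul[OF linear_J0] algebra_simps)

text \<open>
The determinant of a product of complex matrices.
\<close>

lemma Upsilon0_complex_linear_ext:
  "Upsilon0 (\<lambda>i. complex_linear_ext a b c (v i)) = Upsilon0 v * Upsilon0 (vec3 a b c)"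
proof -
  define F :: "complex^3^3" where "F = vector [cplx_coords a, cplx_coords b, cplx_coords c]"
  define M :: "complex^3^3" where "M = vector [cplx_coords (v 0), cplx_coords (v 1), cplx_coords (v 2)]"
  have row: "cplx_coords (complex_linear_ext a b c x) $ k = (\<Sum>p\<in>UNIV. cplx_coords x $ p * F $ p $ k)" for x k
    using exhaust_3[of k]
    by (auto simp: complex_linear_ext_def F_def sum_3 cplx_coords_simps complex_eq_iff algebra_simps)
  have "(M ** F) = vector [cplx_coords (complex_linear_ext a b c (v 0)), cplx_coords (complex_linear_ext a b c (v 1)),
      cplx_coords (complex_linear_ext a b c (v 2))]"
    by (simp add: vec_eq_iff forall_3[where P = "\<lambda>i. \<forall>j. _ i j"] matrix_matrix_mult_def row M_def)
  then have "Upsilon0 (\<lambda>i. complex_linear_ext a b c (v i)) = det (M ** F)" by (simp add: Upsilon0_eq_det)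
  then show ?thesis by (simp add: det_mul M_def F_def Upsilon0_eq_det)
qed

lemma orthogonal_transformation_complex_linear_ext:
  assumes orth: "a \<bullet> a = 1" "b \<bullet> b = 1" "c \<bullet> c = 1" "a \<bullet> b = 0" "a \<bullet> c = 0" "b \<bullet> c = 0"
    and lag: "a \<bullet> J0 b = 0" "a \<bullet> J0 c = 0" "b \<bullet> J0 c = 0"
  shows "orthogonal_transformation (complex_linear_ext a b c)"
proof -
  have self: "x \<bullet> J0 x = 0" "J0 x \<bullet> x = 0" for x by (simp_all add: inner_real6)
  have lag': "b \<bullet> J0 a = 0" "c \<bullet> J0 a = 0" "c \<bullet> J0 b = 0"
    using lag by (simp_all add: inner_J0_skew[of b a] inner_J0_skew[of c])
  have lag'': "J0 a \<bullet> b = 0" "J0 a \<bullet> c = 0" "J0 b \<bullet> c = 0" "J0 b \<bullet> a = 0" "J0 c \<bullet> a = 0" "J0 c \<bullet> b = 0"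
    using lag lag' by (simp_all add: J0_inner_left)
  have orth': "b \<bullet> a = 0" "c \<bullet> a = 0" "c \<bullet> b = 0" using orth by (simp_all add: inner_commute)
  show ?thesis
    unfolding orthogonal_transformation_def
    by (simp add: linear_complex_linear_ext complex_linear_ext_def inner_add_left inner_add_right orth orth' lag lag' lag'' self)
     (simp add: inner_real6)
qed

text \<open>
An orthonormal basis of \<open>T\<close> is unitary since \<open>Omega0\<close> vanishes on \<open>T\<close>, so that \<open>Upsilon0\<close> has modulus 1 on it;
as the value is real, it is \<open>\<plusminus>1\<close>. After a change of sign of one vector the basis spans a complex linear
isometry of complex determinant 1, that is, an element of SU(3).
\<close>

lemma special_lagrangian_model_frame:
  assumes T: "subspace T" "dim T = 3" and lag: "\<And>x y. x \<in> T \<Longrightarrow> y \<in> T \<Longrightarrow> Omega0 (pair_seq x y) = 0"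
    and real: "\<And>x y z. x \<in> T \<Longrightarrow> y \<in> T \<Longrightarrow> z \<in> T \<Longrightarrow> Im (Upsilon0 (vec3 x y z)) = 0"
  obtains g where "orthogonal_transformation g" "\<And>v. Omega0 (\<lambda>i. g (v i)) = Omega0 v"
    "\<And>v. Upsilon0 (\<lambda>i. g (v i)) = Upsilon0 v" "T = g ` span {basis_vec 1, basis_vec 2, basis_vec 3}"
proof -
  obtain B where B: "B \<subseteq> T" "pairwise orthogonal B" "\<And>x. x \<in> B \<Longrightarrow> norm x = 1" "independent B" "card B = dim T" "span B = T"
    using orthonormal_basis_subspace[OF T(1)] by blast
  then obtain a b c where abc: "B = {a, b, c}" "a \<noteq> b" "a \<noteq> c" "b \<noteq> c" using T(2) by (metis card_3_iff)
  have inT: "a \<in> T" "b \<in> T" "c \<in> T" using B abc by auto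
  have Om: "x \<bullet> J0 y = 0" if "x \<in> T" "y \<in> T" for x y
    using lag[OF that] unfolding Omega0_pair pair_seq_def by simp
  have orth: "a \<bullet> a = 1" "b \<bullet> b = 1" "c \<bullet> c = 1" "a \<bullet> b = 0" "a \<bullet> c = 0" "b \<bullet> c = 0"
    using B(2,3) abc by (simp_all add: norm_eq_1 pairwise_insert orthogonal_def)
  define d where "d = Re (Upsilon0 (vec3 a b c))"
  have Ud: "Upsilon0 (vec3 a b c) = of_real d" unfolding d_def using real[OF inT] by (simp add: complex_eq_iff)
  have "cmod (Upsilon0 (vec3 a b c)) = 1" by (rule Upsilon0_unit[OF orth]) (use Om inT in auto)
  then have "\<bar>d\<bar> = 1" unfolding Ud by simp
  then have dd: "d * d = 1" by (metis abs_mult_self mult_1)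
  \<comment> \<open>Since \<open>d = \<plusminus>1\<close>, scaling \<open>a\<close> by \<open>d\<close> multiplies the value \<open>d\<close> of \<open>Upsilon0\<close> to \<open>d\<^sup>2 = 1\<close>.\<close>
  define g where "g = complex_linear_ext (d *\<^sub>R a) b c"
  have daT: "d *\<^sub>R a \<in> T" using T(1) inT(1) by (rule subspace_scale)
  have og: "orthogonal_transformation g"
    unfolding g_def by (rule orthogonal_transformation_complex_linear_ext) (use orth dd Om inT daT in auto)
  have "Upsilon0 (vec3 (d *\<^sub>R a) b c) = d * Upsilon0 (vec3 a b c)"
    by (simp add: Upsilon0_expand Let_def cplx_coords_scaleR algebra_simps)
  then have "Upsilon0 (vec3 (d *\<^sub>R a) b c) = 1" unfolding Ud by (simp flip: of_real_mult add: dd)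
  then have Ug: "Upsilon0 (\<lambda>i. g (v i)) = Upsilon0 v" for v unfolding g_def Upsilon0_complex_linear_ext by simp
  have Og: "Omega0 (\<lambda>i. g (v i)) = Omega0 v" for v
    unfolding Omega0_pair using og complex_linear_ext_J0[of "d *\<^sub>R a" b c, folded g_def, symmetric]
    by (simp add: orthogonal_transformation_def)
  have "g ` span {basis_vec 1, basis_vec 2, basis_vec 3} = span {d *\<^sub>R a, b, c}"
    using linear_span_image[of g "{basis_vec 1, basis_vec 2, basis_vec 3}"] linear_complex_linear_ext
    by (simp add: g_def complex_linear_ext_basis)
  also have "\<dots> = T"
  proof
    show "span {d *\<^sub>R a, b, c} \<subseteq> T" using daT inT T(1) by (intro span_minimal) auto
    have "d *\<^sub>R (d *\<^sub>R a) \<in> span {d *\<^sub>R a, b, c}" by (intro span_scale span_base) simp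
    then have "a \<in> span {d *\<^sub>R a, b, c}" by (simp add: dd)
    then have "span {a, b, c} \<subseteq> span {d *\<^sub>R a, b, c}"
      by (intro span_minimal subspace_span) (auto intro: span_base)
    then show "T \<subseteq> span {d *\<^sub>R a, b, c}" using B(6) abc by simp
  qed
  finally show thesis using that og Og Ug by blast
qed

lemma span_basis_123: "x \<in> span {basis_vec 1, basis_vec 2, basis_vec 3} \<longleftrightarrow> x$4 = 0 \<and> x$5 = 0 \<and> x$6 = 0"
  and span_basis_456: "x \<in> span {basis_vec 4, basis_vec 5, basis_vec 6} \<longleftrightarrow> x$1 = 0 \<and> x$2 = 0 \<and> x$3 = 0"
proof -
  have r: "x = x$1 *\<^sub>R basis_vec 1 + x$2 *\<^sub>R basis_vec 2 + x$3 *\<^sub>R basis_vec 3" if "x$4 = 0 \<and> x$5 = 0 \<and> x$6 = 0"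
    using that by (simp add: vec6_eq_iff basis_vec_nth)
  show "x \<in> span {basis_vec 1, basis_vec 2, basis_vec 3} \<longleftrightarrow> x$4 = 0 \<and> x$5 = 0 \<and> x$6 = 0" (is "?l = ?r")
  proof
    assume ?r show ?l by (subst r[OF \<open>?r\<close>], intro span_add span_scale span_base) auto
  next
    assume ?l then show ?r
      by (rule span_induct) (auto simp: subspace_def basis_vec_nth)
  qed
  have r: "x = x$4 *\<^sub>R basis_vec 4 + x$5 *\<^sub>R basis_vec 5 + x$6 *\<^sub>R basis_vec 6" if "x$1 = 0 \<and> x$2 = 0 \<and> x$3 = 0"
    using that by (simp add: vec6_eq_iff basis_vec_nth)
  show "x \<in> span {basis_vec 4, basis_vec 5, basis_vec 6} \<longleftrightarrow> x$1 = 0 \<and> x$2 = 0 \<and> x$3 = 0" (is "?l = ?r")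
  proof
    assume ?r show ?l by (subst r[OF \<open>?r\<close>], intro span_add span_scale span_base) auto
  next
    assume ?l then show ?r
      by (rule span_induct) (auto simp: subspace_def basis_vec_nth)
  qed
qed

lemma orthogonal_complement_123:
  "{x. \<forall>y\<in>span {basis_vec 1, basis_vec 2, basis_vec 3}. y \<bullet> x = 0} = span {basis_vec 4, basis_vec 5, basis_vec 6}"
proof (intro set_eqI iffI)
  fix x assume "x \<in> {x. \<forall>y\<in>span {basis_vec 1, basis_vec 2, basis_vec 3}. y \<bullet> x = 0}"
  then have "basis_vec 1 \<bullet> x = 0" "basis_vec 2 \<bullet> x = 0" "basis_vec 3 \<bullet> x = 0" by (auto intro: span_base)
  then show "x \<in> span {basis_vec 4, basis_vec 5, basis_vec 6}"
    by (simp add: span_basis_456 inner_real6 basis_vec_nth)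
qed (auto simp: span_basis_123 span_basis_456 inner_real6)

text \<open>
Multiplication by \<open>e\<^bsup>-i\<theta>/3\<^esup>\<close> scales \<open>\<Upsilon>\<close> by \<open>e\<^bsup>-i\<theta>\<^esup>\<close> and preserves \<open>\<Omega>\<close>, so it turns \<open>E\<close> into a special
Lagrangian plane of phase 0. In the coordinates of any frame \<open>u0\<close> this is the image of the span of
\<open>e\<^sub>1, e\<^sub>2, e\<^sub>3\<close> under some \<open>g\<close> in SU(3), and \<open>inv g \<circ> u0\<close> is the adapted frame.
\<close>

lemma adapted_frame_exists:
  assumes u0: "su3_frame \<Omega> \<Upsilon> u0" and E: "special_lagrangian_plane \<Omega> \<Upsilon> \<theta> E"
  shows "\<exists>u. adapted_frame \<Omega> \<Upsilon> (complex_mult \<Omega> \<Upsilon> (cis (- \<theta> / 3)) ` E) u"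
proof -
  note U0 = su3_frameD[OF u0]
  let ?z = "cis (- \<theta> / 3)"
  define S where "S = (\<lambda>x. cscale ?z (u0 x)) ` E"
  have lin: "linear (\<lambda>x. cscale ?z (u0 x))"
    using linear_compose[OF U0(1) linear_cscale] by (simp add: comp_def)
  have inj: "inj (\<lambda>x. cscale ?z (u0 x))"
  proof (rule injI)
    fix x y assume "cscale ?z (u0 x) = cscale ?z (u0 y)"
    then have "cscale (cis (\<theta> / 3)) (cscale ?z (u0 x)) = cscale (cis (\<theta> / 3)) (cscale ?z (u0 y))" by simp
    then have "u0 x = u0 y" by (simp add: cscale_cscale cis_mult)
    then show "x = y" by (metis U0(4))
  qed
  have z3: "?z ^ 3 = cis (- \<theta>)" by (subst Complex.DeMoivre) simp
  have E': "subspace E" "dim E = 3" "vanishes_on \<Omega> E" "vanishes_on (Im_form (\<lambda>v. cis (- \<theta>) * \<Upsilon> v)) E"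
    using E unfolding special_lagrangian_plane_def by auto
  have S1: "subspace S" unfolding S_def using lin E'(1) by (rule linear_subspace_image)
  have S2: "dim S = 3" unfolding S_def using dim_image_eq[OF lin, of E] inj E'(2) by (simp add: inj_on_subset)
  have S3: "Omega0 (pair_seq x y) = 0" if xS: "x \<in> S" "y \<in> S" for x y
  proof -
    obtain x' y' where xy: "x' \<in> E" "y' \<in> E" "x = cscale ?z (u0 x')" "y = cscale ?z (u0 y')" using xS unfolding S_def by blast
    have "Omega0 (pair_seq x y) = Omega0 (\<lambda>i. cscale ?z (pair_seq (u0 x') (u0 y') i))" unfolding xy comp_pair_seq ..
    also have "\<dots> = \<Omega> (pair_seq x' y')" unfolding Omega0_cscale by (simp add: U0(6)[of "pair_seq x' y'"] comp_pair_seq)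
    also have "\<dots> = 0" using E'(3) xy(1,2) by (simp add: vanishes_on_def range_pair_seq)
    finally show ?thesis .
  qed
  have S4: "Im (Upsilon0 (vec3 x y w)) = 0" if xS: "x \<in> S" "y \<in> S" "w \<in> S" for x y w
  proof -
    obtain x' y' w' where xy: "x' \<in> E" "y' \<in> E" "w' \<in> E" "x = cscale ?z (u0 x')" "y = cscale ?z (u0 y')" "w = cscale ?z (u0 w')"
      using xS unfolding S_def by blast
    have "Upsilon0 (vec3 x y w) = Upsilon0 (\<lambda>i. cscale ?z (vec3 (u0 x') (u0 y') (u0 w') i))" unfolding xy comp_vec3 ..
    also have "\<dots> = cis (- \<theta>) * \<Upsilon> (vec3 x' y' w')" unfolding Upsilon0_cscale z3 U0(7)[of "vec3 x' y' w'"] comp_vec3[of u0] ..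
    finally show ?thesis using E'(4) xy(1,2,3) by (simp add: vanishes_on_def Im_form_def range_vec3)
  qed
  obtain g where g: "orthogonal_transformation g" "\<And>v. Omega0 (\<lambda>i. g (v i)) = Omega0 v"
    "\<And>v. Upsilon0 (\<lambda>i. g (v i)) = Upsilon0 v" "S = g ` span {basis_vec 1, basis_vec 2, basis_vec 3}"
    using special_lagrangian_model_frame[OF S1 S2 S3 S4] by blast
  have bg: "bij g" using g(1) by (rule orthogonal_transformation_bij)
  have lg: "linear g" using g(1) by (rule orthogonal_transformation_linear)
  have gi: "g (inv g x) = x" "inv g (g x) = x" for x using bg by (simp_all add: bij_is_surj surj_f_inv_f bij_is_inj)
  have lgi: "linear (inv g)" using lg bg by (metis bij_is_inj inj_linear_imp_inv_linear)
  define u where "u x = inv g (u0 x)" for x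
  have u_comp: "u = inv g \<circ> u0" by (auto simp: u_def)
  have bu: "bij u" unfolding u_comp using bg U0(2) by (intro bij_comp bij_imp_bij_inv)
  have u: "su3_frame \<Omega> \<Upsilon> u"
    unfolding su3_frame_def
  proof (intro conjI bu)
    show "linear u" unfolding u_comp using U0(1) lgi by (rule linear_compose)
    show "\<Omega> = pull u Omega0"
    proof
      fix v show "\<Omega> v = pull u Omega0 v"
        using g(2)[of "\<lambda>i. inv g (u0 (v i))"] unfolding pull_def u_def gi U0(6)[of v] by simp
    qed
    show "\<Upsilon> = pull u Upsilon0"
    proof
      fix v show "\<Upsilon> v = pull u Upsilon0 v"
        using g(3)[of "\<lambda>i. inv g (u0 (v i))"] unfolding pull_def u_def gi U0(7)[of v] by simp
    qed
  qed
  note U = su3_frameD[OF u]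
  have span3: "inv u ` span {x, y, w} = span {inv u x, inv u y, inv u w}" for x y w
    using linear_span_image[OF U(5), of "{x, y, w}"] by simp
  let ?T = "complex_mult \<Omega> \<Upsilon> ?z ` E"
  have inv_u: "inv u x = inv u0 (g x)" for x
    by (metis U(4) U0(3) gi(2) u_def)
  have "?T = inv u0 ` S" unfolding S_def image_image complex_mult_frame[OF u0] ..
  also have "\<dots> = inv u ` span {basis_vec 1, basis_vec 2, basis_vec 3}" unfolding g(4) image_image inv_u ..
  finally have T: "?T = inv u ` span {basis_vec 1, basis_vec 2, basis_vec 3}" .
  have "{w. \<forall>v\<in>?T. induced_g \<Omega> \<Upsilon> v w = 0} = {w. u w \<in> span {basis_vec 4, basis_vec 5, basis_vec 6}}"
    unfolding T induced_g_frame[OF u] orthogonal_complement_123[symmetric] by (auto simp: U(3))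
  also have "\<dots> = inv u ` span {basis_vec 4, basis_vec 5, basis_vec 6}"
    using U(3,4) by (auto simp: image_iff) metis
  finally show ?thesis
    using T u unfolding adapted_frame_def span3 by blast
qed

section \<open>Evaluation on a rotated Lagrangian plane\<close>

lemma alt_form_3_linear:
  assumes "alt_form 3 \<alpha>"
  shows "linear (\<lambda>a. \<alpha> (vec3 a b c))" "linear (\<lambda>b. \<alpha> (vec3 a b c))" "linear (\<lambda>c. \<alpha> (vec3 a b c))"
proof -
  have lin: "linear (\<lambda>x. \<alpha> ((vec3 a b c)(i := x)))" if "i < 3" for a b c i
    using assms that unfolding alt_form_def by blast
  have "\<alpha> ((vec3 a b c)(0 := x)) = \<alpha> (vec3 x b c)" "\<alpha> ((vec3 a b c)(1 := x)) = \<alpha> (vec3 a x c)"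
     "\<alpha> ((vec3 a b c)(2 := x)) = \<alpha> (vec3 a b x)" for a b c x
    by (rule alt_form_cong[OF assms]; auto simp: vec3_def less_3_cases)+
  with lin[of 0] lin[of 1] lin[of 2] show "linear (\<lambda>a. \<alpha> (vec3 a b c))" "linear (\<lambda>b. \<alpha> (vec3 a b c))" "linear (\<lambda>c. \<alpha> (vec3 a b c))"
    by simp_all
qed

lemma alt_form_3_swap:
  assumes "alt_form 3 \<alpha>"
  shows "\<alpha> (vec3 b a c) = - \<alpha> (vec3 a b c)" "\<alpha> (vec3 a c b) = - \<alpha> (vec3 a b c)"
proof -
  have "\<alpha> (vec3 b a c) = \<alpha> (\<lambda>m. vec3 a b c (Transposition.transpose 0 1 m))"
    by (rule alt_form_cong[OF assms]) (auto simp: vec3_def Transposition.transpose_def less_3_cases)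
  also have "\<dots> = - \<alpha> (vec3 a b c)" by (rule alt_form_swap[OF assms]) auto
  finally show "\<alpha> (vec3 b a c) = - \<alpha> (vec3 a b c)" .
  have "\<alpha> (vec3 a c b) = \<alpha> (\<lambda>m. vec3 a b c (Transposition.transpose 1 2 m))"
    by (rule alt_form_cong[OF assms]) (auto simp: vec3_def Transposition.transpose_def less_3_cases)
  also have "\<dots> = - \<alpha> (vec3 a b c)" by (rule alt_form_swap[OF assms]) auto
  finally show "\<alpha> (vec3 a c b) = - \<alpha> (vec3 a b c)" .
qed

lemma Lambda3_12_pull:
  assumes u: "su3_frame \<Omega> \<Upsilon> u" and \<gamma>: "\<gamma> \<in> Lambda3_12 \<Omega> \<Upsilon>"
  shows "alt_form 3 (pull (inv u) \<gamma>)"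
    "wedge 3 3 (pull (inv u) \<gamma>) (Re_form Upsilon0) = (\<lambda>v. 0)"
    "wedge 3 3 (pull (inv u) \<gamma>) (Im_form Upsilon0) = (\<lambda>v. 0)"
proof -
  note U = su3_frameD[OF u]
  have g: "alt_form 3 \<gamma>" "wedge 3 3 \<gamma> (Re_form \<Upsilon>) = (\<lambda>v. 0)" "wedge 3 3 \<gamma> (Im_form \<Upsilon>) = (\<lambda>v. 0)"
    using \<gamma> unfolding Lambda3_12_def by auto
  show "alt_form 3 (pull (inv u) \<gamma>)" using U(5) g(1) by (rule alt_form_pull)
  have Re: "Re_form Upsilon0 = pull (inv u) (Re_form \<Upsilon>)" and Im: "Im_form Upsilon0 = pull (inv u) (Im_form \<Upsilon>)"
    by (simp_all add: fun_eq_iff pull_def Re_form_def Im_form_def U(3,7))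
  show "wedge 3 3 (pull (inv u) \<gamma>) (Re_form Upsilon0) = (\<lambda>v. 0)"
    "wedge 3 3 (pull (inv u) \<gamma>) (Im_form Upsilon0) = (\<lambda>v. 0)"
    unfolding Re Im wedge_pull g by (simp_all add: pull_def)
qed

text \<open>
Of the eight components in the expansion, those with mixed weights \<open>cos\<^sup>2 sin\<close> and \<open>cos sin\<^sup>2\<close> combine to the
components 456 and 123, and \<open>cos\<^sup>2 + sin\<^sup>2\<close> factors out.
\<close>

lemma rotated_plane_value:
  assumes a: "alt_form 3 \<gamma>" 
    and re: "wedge 3 3 \<gamma> (Re_form Upsilon0) = (\<lambda>v. 0)" and im: "wedge 3 3 \<gamma> (Im_form Upsilon0) = (\<lambda>v. 0)"
  shows "\<gamma> (vec3 (cscale (cis t) (basis_vec 1)) (cscale (cis t) (basis_vec 2)) (cscale (cis t) (basis_vec 3))) =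
    cos t * \<gamma> (vec3 (basis_vec 1) (basis_vec 2) (basis_vec 3)) + sin t * \<gamma> (vec3 (basis_vec 4) (basis_vec 5) (basis_vec 6))"
proof -
  define e where "e i j k = \<gamma> (vec3 (basis_vec i) (basis_vec j) (basis_vec k))" for i j k
  note L = alt_form_3_linear[OF a]
  note lin = linear_add[OF L(1)] linear_add[OF L(2)] linear_add[OF L(3)] linear_cmul[OF L(1)] linear_cmul[OF L(2)] linear_cmul[OF L(3)]
  have P: "e 4 2 3 + e 1 5 3 + e 1 2 6 = e 4 5 6" and Q: "e 1 5 6 + e 4 2 6 + e 4 5 3 = e 1 2 3"
    using Lambda3_12_component_relations[OF a re im] unfolding e_def by auto
  let ?c = "cos t" and ?s = "sin t"
  have one: "?s * ?s + ?c * ?c = 1" using sin_cos_squared_add[of t] by (simp only: power2_eq_square)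
  have "\<gamma> (vec3 (cscale (cis t) (basis_vec 1)) (cscale (cis t) (basis_vec 2)) (cscale (cis t) (basis_vec 3))) =
     ?c * ?c * ?c * e 1 2 3 + ?c * ?c * ?s * (e 4 2 3 + e 1 5 3 + e 1 2 6)
     + ?c * ?s * ?s * (e 1 5 6 + e 4 2 6 + e 4 5 3) + ?s * ?s * ?s * e 4 5 6"
    unfolding cscale_def J0_basis cis.simps lin e_def by (simp add: algebra_simps)
  also have "\<dots> = (?s * ?s + ?c * ?c) * (?c * e 1 2 3 + ?s * e 4 5 6)"
    unfolding P Q by algebra
  also have "\<dots> = ?c * e 1 2 3 + ?s * e 4 5 6"
    unfolding one by simp
  finally show ?thesis unfolding e_def .
qed

lemma Theta0_Delta0_vec3: 
  "Theta0 (vec3 x y z) = - Re (Upsilon0 (vec3 x y z)) + 4 * cov3 1 2 3 (vec3 x y z)"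
  "Delta0 (vec3 x y z) = - Im (Upsilon0 (vec3 x y z)) - 4 * cov3 4 5 6 (vec3 x y z)"
  by (simp_all add: Theta0_def Delta0_def Re_form_def Im_form_def)

lemma form3_inner_expand: "form3_inner \<alpha> \<beta> = (let p = (\<lambda>i j k. \<alpha> (vec3 (basis_vec i) (basis_vec j) (basis_vec k)) *
     \<beta> (vec3 (basis_vec i) (basis_vec j) (basis_vec k))) in
   p 1 2 3 + p 1 2 4 + p 1 2 5 + p 1 2 6 + p 1 3 4 + p 1 3 5 + p 1 3 6 + p 1 4 5 + p 1 4 6 + p 1 5 6 +
   p 2 3 4 + p 2 3 5 + p 2 3 6 + p 2 4 5 + p 2 4 6 + p 2 5 6 + p 3 4 5 + p 3 4 6 + p 3 5 6 + p 4 5 6)"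
proof -
  have i: "{1..6::nat} = {1,2,3,4,5,6}" "{2..6::nat} = {2,3,4,5,6}" "{3..6::nat} = {3,4,5,6}" "{4..6::nat} = {4,5,6}"
    "{5..6::nat} = {5,6}" "{6..6::nat} = {6}" "{7..6::nat} = {}" "{8..6::nat} = {}" by auto
  show ?thesis unfolding form3_inner_def Let_def by (simp add: i del: One_nat_def)
qed

text \<open>
\<open>Theta0\<close> has coefficient 3 at 123 and \<open>1\<close>, up to the sign of reordering, at the three components that add up
to the component 123; hence the coefficient \<open>4 = 3 + 1\<close>. For \<open>Delta0\<close> and 456 the signs are opposite.
\<close>

lemma form3_inner_Theta0_Delta0:
  assumes a: "alt_form 3 \<gamma>" 
    and re: "wedge 3 3 \<gamma> (Re_form Upsilon0) = (\<lambda>v. 0)" and im: "wedge 3 3 \<gamma> (Im_form Upsilon0) = (\<lambda>v. 0)"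
  shows "form3_inner \<gamma> Theta0 = 4 * \<gamma> (vec3 (basis_vec 1) (basis_vec 2) (basis_vec 3))"
    "form3_inner \<gamma> Delta0 = - 4 * \<gamma> (vec3 (basis_vec 4) (basis_vec 5) (basis_vec 6))"
proof -
  define e where "e i j k = \<gamma> (vec3 (basis_vec i) (basis_vec j) (basis_vec k))" for i j k
  have P: "e 4 2 3 + e 1 5 3 + e 1 2 6 = e 4 5 6" and Q: "e 1 5 6 + e 4 2 6 + e 4 5 3 = e 1 2 3"
    using Lambda3_12_component_relations[OF a re im] unfolding e_def by auto
  have sw: "e j i k = - e i j k" "e i k j = - e i j k" for i j k
    unfolding e_def by (rule alt_form_3_swap[OF a])+
  have "form3_inner \<gamma> Theta0 = 3 * e 1 2 3 + e 1 5 6 - e 2 4 6 + e 3 4 5"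
    unfolding form3_inner_expand Let_def Theta0_Delta0_vec3 e_def[symmetric]
    by (simp add: Upsilon0_expand cov3_eq cplx_coords_simps basis_vec_nth)
  then show "form3_inner \<gamma> Theta0 = 4 * \<gamma> (vec3 (basis_vec 1) (basis_vec 2) (basis_vec 3))"
    unfolding e_def[symmetric] using Q sw(1)[of 2 4 6] sw(2)[of 4 3 5] sw(1)[of 3 4 5] by simp
  have "form3_inner \<gamma> Delta0 = - 3 * e 4 5 6 - e 1 2 6 + e 1 3 5 - e 2 3 4"
    unfolding form3_inner_expand Let_def Theta0_Delta0_vec3 e_def[symmetric]
    by (simp add: Upsilon0_expand cov3_eq cplx_coords_simps basis_vec_nth)
  then show "form3_inner \<gamma> Delta0 = - 4 * \<gamma> (vec3 (basis_vec 4) (basis_vec 5) (basis_vec 6))"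
    unfolding e_def[symmetric] using P sw(2)[of 1 3 5] sw(1)[of 2 4 3] sw(2)[of 2 3 4] by simp
qed

lemma form3_inner_self: "form3_inner Theta0 Theta0 = 12" "form3_inner Delta0 Delta0 = 12"
  unfolding form3_inner_expand Let_def Theta0_Delta0_vec3
  by (simp_all add: Upsilon0_expand cov3_eq cplx_coords_simps basis_vec_nth)

lemma dagger_scale: "dagger (\<lambda>v. r * Theta0 v) = r * (2 * sqrt 3)" "ddagger (\<lambda>v. r * Delta0 v) = r * (2 * sqrt 3)"
proof -
  have "Theta0 (vec3 (basis_vec 1) (basis_vec 2) (basis_vec 3)) \<noteq> 0" "Delta0 (vec3 (basis_vec 4) (basis_vec 5) (basis_vec 6)) \<noteq> 0"
    unfolding Theta0_Delta0_vec3 by (simp_all add: Upsilon0_expand cov3_eq cplx_coords_simps basis_vec_nth)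
  then have "(THE a. (\<lambda>v. r * Theta0 v) = (\<lambda>v. a * Theta0 v)) = r" "(THE a. (\<lambda>v. r * Delta0 v) = (\<lambda>v. a * Delta0 v)) = r"
    by (auto simp: fun_eq_iff)
  then show "dagger (\<lambda>v. r * Theta0 v) = r * (2 * sqrt 3)" "ddagger (\<lambda>v. r * Delta0 v) = r * (2 * sqrt 3)"
    unfolding dagger_def ddagger_def by simp_all
qed

text \<open>
The factor is \<open>4 / 12\<close> from the projection times \<open>2 \<surd>3\<close> from the normalisation of the isometries.
\<close>

lemma dagger_refined:
  assumes u: "su3_frame \<Omega> \<Upsilon> u" and \<gamma>: "\<gamma> \<in> Lambda3_12 \<Omega> \<Upsilon>"
  shows "dagger (refined' u \<gamma>) = 2 * sqrt 3 / 3 * pull (inv u) \<gamma> (vec3 (basis_vec 1) (basis_vec 2) (basis_vec 3))"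
    "ddagger (refined'' u \<gamma>) = - 2 * sqrt 3 / 3 * pull (inv u) \<gamma> (vec3 (basis_vec 4) (basis_vec 5) (basis_vec 6))"
  unfolding refined'_def refined''_def line_proj_def dagger_scale form3_inner_self
    form3_inner_Theta0_Delta0[OF Lambda3_12_pull[OF u \<gamma>]]
  by simp_all

lemma wedge_vanishes_on:
  assumes "vanishes_on \<beta> E" "range v \<subseteq> E"
  shows "wedge k l \<alpha> \<beta> v = 0"
proof -
  have "\<beta> (\<lambda>i. v (p (k + i))) = 0" for p
    by (rule assms(1)[unfolded vanishes_on_def, rule_format]) (use assms(2) in auto)
  then show ?thesis unfolding wedge_def by simp
qed

text \<open>
The pointwise statement: the hypothesis on \<open>d\<close> is the vanishing of \<open>d\<Omega>\<close> on \<open>E\<close>, written out in torsion forms.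
\<close>

lemma adapted_frame_identity:
  assumes E: "special_lagrangian_plane \<Omega> \<Upsilon> \<theta> E" and t3: "t3 \<in> Lambda3_12 \<Omega> \<Upsilon>"
    and d: "\<And>v. range v \<subseteq> E \<Longrightarrow>
       3 * t0 * Re_form \<Upsilon> v + 3 * t0h * Im_form \<Upsilon> v + t3 v + wedge 1 2 t4 \<Omega> v = 0"
    and u: "adapted_frame \<Omega> \<Upsilon> (complex_mult \<Omega> \<Upsilon> (cis (- \<theta> / 3)) ` E) u"
  shows "t0h * sin \<theta> + t0 * cos \<theta> = sqrt 3 / 6 * (sin (\<theta> / 3) * ddagger (refined'' u t3)
                             - cos (\<theta> / 3) * dagger (refined' u t3))"
proof -
  have fr: "su3_frame \<Omega> \<Upsilon> u"
    and T: "complex_mult \<Omega> \<Upsilon> (cis (- \<theta> / 3)) ` E = span {inv u (basis_vec 1), inv u (basis_vec 2), inv u (basis_vec 3)}"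
    using u unfolding adapted_frame_def by auto
  note U = su3_frameD[OF fr]
  let ?w = "cis (\<theta> / 3)"
  have inE: "inv u (cscale ?w (basis_vec i)) \<in> E" if "i \<in> {1, 2, 3}" for i
  proof -
    have "inv u (basis_vec i) \<in> complex_mult \<Omega> \<Upsilon> (cis (- \<theta> / 3)) ` E"
      unfolding T using that by (intro span_base) auto
    then obtain x where x: "x \<in> E" "inv u (basis_vec i) = inv u (cscale (cis (- \<theta> / 3)) (u x))"
      unfolding complex_mult_frame[OF fr] by auto
    then have "basis_vec i = cscale (cis (- \<theta> / 3)) (u x)" by (metis U(3))
    then have "cscale ?w (basis_vec i) = u x" by (simp add: cscale_cscale cis_mult)
    then show ?thesis using x(1) by (simp add: U(4))
  qed
  let ?b = "vec3 (basis_vec 1) (basis_vec 2) (basis_vec 3)"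
  define v where "v i = inv u (cscale ?w (?b i))" for i
  have v: "range v \<subseteq> E" using inE by (auto simp: v_def vec3_def)
  \<comment> \<open>\<open>\<Upsilon>\<close> is complex trilinear, which turns the angle \<open>\<theta> / 3\<close> into the phase \<open>\<theta>\<close>.\<close>
  have "?w ^ 3 = cis \<theta>" by (subst Complex.DeMoivre) simp
  moreover have "Upsilon0 ?b = 1"
    by (simp add: Upsilon0_expand cplx_coords_simps basis_vec_nth complex_eq_iff)
  ultimately have Up: "\<Upsilon> v = cis \<theta>" unfolding U(7) v_def U(3) Upsilon0_cscale by simp
  have "vanishes_on \<Omega> E" using E unfolding special_lagrangian_plane_def by auto
  then have "wedge 1 2 t4 \<Omega> v = 0" using v by (rule wedge_vanishes_on)
  with d[OF v] have "3 * t0 * cos \<theta> + 3 * t0h * sin \<theta> + t3 v = 0"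
    by (simp add: Re_form_def Im_form_def Up)
  moreover have "t3 v = pull (inv u) t3 (vec3 (cscale ?w (basis_vec 1)) (cscale ?w (basis_vec 2)) (cscale ?w (basis_vec 3)))"
    unfolding pull_def v_def comp_vec3[of "inv u"] comp_vec3[of "\<lambda>x. inv u (cscale ?w x)"] ..
  ultimately have "3 * t0 * cos \<theta> + 3 * t0h * sin \<theta> = - (cos (\<theta> / 3) * pull (inv u) t3 ?b +
      sin (\<theta> / 3) * pull (inv u) t3 (vec3 (basis_vec 4) (basis_vec 5) (basis_vec 6)))"
    unfolding rotated_plane_value[OF Lambda3_12_pull[OF fr t3]] by simp
  moreover have "sqrt 3 / 6 * (x * (- 2 * sqrt 3 / 3 * y) - x' * (2 * sqrt 3 / 3 * y')) = - (x' * y' + x * y) / 3"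
    for x y x' y' :: real
  proof -
    have "r / 6 * (x * (- 2 * r / 3 * y) - x' * (2 * r / 3 * y')) = (r * r) * (- (x' * y' + x * y) / 9)" for r :: real
      by (simp add: field_simps)
    from this[of "sqrt 3"] show ?thesis by simp
  qed
  ultimately show ?thesis unfolding dagger_refined[OF fr t3] by simp
qed


section \<open>Special Lagrangian immersions\<close>

lemma chart_inv_apply:
  assumes "smooth_manifold X A" "c \<in> A" "p \<in> fst c"
  shows "chart_inv c (snd c p) = p"
proof -
  have "homeomorphic_map (subtopology X (fst c)) (top_of_set (chart_img c)) (snd c)" and "openin X (fst c)"
    using assms unfolding smooth_manifold_def by auto
  then have "inj_on (snd c) (fst c)"
    unfolding homeomorphic_eq_everything_map by (simp add: inf.absorb2 openin_subset)
  then show ?thesis using assms(3) by (simp add: chart_inv_def)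
qed

lemma chart_image_open:
  fixes c :: "('m, 'n::finite) chart"
  assumes "smooth_manifold X A" "c \<in> A" "openin X U" "U \<subseteq> fst c"
  shows "open (snd c ` U)"
proof -
  have h: "homeomorphic_map (subtopology X (fst c)) (top_of_set (chart_img c)) (snd c)" and o: "open (chart_img c)"
    using assms unfolding smooth_manifold_def by auto
  have "openin (subtopology X (fst c)) U" 
    using assms(3,4) by (auto simp: openin_subtopology)
  then have "openin (top_of_set (chart_img c)) (snd c ` U)"
    using h unfolding homeomorphic_eq_everything_map open_map_def by blast
  then show ?thesis using o by (simp add: openin_open_eq)
qed

text \<open>
In charts, \<open>f\<close> is a smooth map between open subsets of \<open>\<real>\<^sup>3\<close> and \<open>\<real>\<^sup>6\<close> that pulls \<open>\<Omega>\<close> back to zero.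
\<close>

lemma dOmega_vanishes_on_special_lagrangian:
  fixes A :: "('m, 6) chart set" and B :: "('s, 3) chart set"
  assumes X: "smooth_manifold X A" and \<Omega>: "diff_form A 2 \<Omega>" and L: "special_lagrangian_3fold X A \<Omega> \<Upsilon> \<theta> Y B f"
    and p: "b \<in> B" "c \<in> A" "p \<in> fst b" "f p \<in> fst c"
    and v: "range v \<subseteq> range (local_diff f b c p)"
  shows "ext_deriv 2 (\<Omega> c) (snd c (f p)) v = 0"
proof -
  have Y: "smooth_manifold Y B" and im: "immersion Y B X A f"
    and sl: "\<And>q. q \<in> fst b \<Longrightarrow> f q \<in> fst c \<Longrightarrow>
        special_lagrangian_plane (\<Omega> c (snd c (f q))) (\<Upsilon> c (snd c (f q))) \<theta> (range (local_diff f b c q))"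
    using L p(1,2) unfolding special_lagrangian_3fold_def by auto
  define W where "W = {q \<in> fst b. f q \<in> fst c}"
  define U where "U = snd b ` W"
  define F where "F = local_rep f b c"
  have cont: "continuous_map Y X f" and sm: "smooth_on U F"
    using im p(1,2) unfolding immersion_def smooth_map_def U_def W_def F_def by auto
  have opb: "openin Y (fst b)" and opc: "openin X (fst c)" "open (chart_img c)"
    using X Y p(1,2) unfolding smooth_manifold_def by auto
  have "openin Y (fst b \<inter> {q \<in> topspace Y. f q \<in> fst c})"
    using openin_continuous_map_preimage[OF cont opc(1)] opb by (rule openin_Int[rotated])
  moreover have "fst b \<inter> {q \<in> topspace Y. f q \<in> fst c} = W"
    using openin_subset[OF opb] unfolding W_def by auto
  ultimately have U: "open U" unfolding U_def using chart_image_open[OF Y p(1)] by (auto simp: W_def)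
  have F_at: "F (snd b q) = snd c (f q)" if "q \<in> W" for q
    using chart_inv_apply[OF Y p(1), of q] that by (simp add: F_def local_rep_def W_def)
  have pW: "p \<in> W" using p by (simp add: W_def)
  have FV: "F y \<in> chart_img c" if "y \<in> U" for y
    using that F_at by (auto simp: U_def W_def chart_img_def)
  have alt: "alt_form 2 (\<Omega> c z)" and sO: "smooth_on (chart_img c) (\<lambda>y. \<Omega> c y w)" if "z \<in> chart_img c" for z w
    using \<Omega> p(2) that unfolding diff_form_def by auto
  have diff: "(\<lambda>z. \<Omega> c z w) differentiable at z" if "z \<in> chart_img c" for z w
  proof -
    have "Ck_on (Suc 0) (chart_img c) (\<lambda>y. \<Omega> c y w)" using sO[OF that] unfolding smooth_on_def by blast
    then show ?thesis using that by simp
  qed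
  have "ext_deriv 2 (\<Omega> c) (F (snd b p)) v = 0"
  proof (rule ext_deriv_2_pullback_eq_0[OF opc(2) alt diff U])
    show "snd b p \<in> U" using pW by (simp add: U_def)
    show "Ck_on 2 U F" using sm unfolding smooth_on_def by blast
    show "v i \<in> range (frechet_derivative F (at (snd b p)))" for i
      using v unfolding local_diff_def F_def by auto
    show "\<Omega> c (F y) (pair_seq (frechet_derivative F (at y) a) (frechet_derivative F (at y) a')) = 0" if "y \<in> U" for y a a'
    proof -
      obtain q where q: "q \<in> W" "y = snd b q" using \<open>y \<in> U\<close> U_def by auto
      have "vanishes_on (\<Omega> c (snd c (f q))) (range (frechet_derivative F (at (snd b q))))"
        using sl[of q] q(1) unfolding W_def special_lagrangian_plane_def local_diff_def F_def by auto
      then show ?thesis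
        unfolding q(2) F_at[OF q(1)] by (simp add: vanishes_on_def range_pair_seq)
    qed
  qed (assumption | erule FV)+
  then show ?thesis unfolding F_at[OF pW] .
qed

theorem theorem2p17:
  fixes X :: "'m topology" and A :: "('m, 6) chart set"
    and \<Omega> :: "('m, 6, real) dform" and \<Upsilon> :: "('m, 6, complex) dform"
    and \<tau>\<^sub>0 \<tau>\<^sub>0h :: "'m \<Rightarrow> real" and \<tau>\<^sub>2 \<tau>\<^sub>2h \<tau>\<^sub>3 \<tau>\<^sub>4 \<tau>\<^sub>5 :: "('m, 6, real) dform"
    and \<theta> :: real
    and Y :: "'s topology" and B :: "('s, 3) chart set" and f :: "'s \<Rightarrow> 'm"
  assumes "smooth_manifold X A"
    and "su3_structure A \<Omega> \<Upsilon>"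
    and "torsion_forms A \<Omega> \<Upsilon> \<tau>\<^sub>0 \<tau>\<^sub>0h \<tau>\<^sub>2 \<tau>\<^sub>2h \<tau>\<^sub>3 \<tau>\<^sub>4 \<tau>\<^sub>5"
    and "\<theta> \<in> {0..<2 * pi}"
    and "special_lagrangian_3fold X A \<Omega> \<Upsilon> \<theta> Y B f"
  shows
    "(\<forall>p\<in>topspace Y. \<forall>b\<in>B. \<forall>c\<in>A. p \<in> fst b \<and> f p \<in> fst c \<longrightarrow>
       (let y = snd c (f p);
            T = complex_mult (\<Omega> c y) (\<Upsilon> c y) (cis (- \<theta> / 3)) ` range (local_diff f b c p)
        in (\<exists>u. adapted_frame (\<Omega> c y) (\<Upsilon> c y) T u) \<and>
           (\<forall>u. adapted_frame (\<Omega> c y) (\<Upsilon> c y) T u \<longrightarrow>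
             \<tau>\<^sub>0h (f p) * sin \<theta> + \<tau>\<^sub>0 (f p) * cos \<theta> =
               sqrt 3 / 6 * (sin (\<theta> / 3) * ddagger (refined'' u (\<tau>\<^sub>3 c y))
                             - cos (\<theta> / 3) * dagger (refined' u (\<tau>\<^sub>3 c y)))))) \<and>
     ((\<forall>c\<in>A. \<forall>y\<in>chart_img c. \<tau>\<^sub>3 c y = (\<lambda>v. 0)) \<longrightarrow>
       (\<forall>p\<in>topspace Y. \<tau>\<^sub>0h (f p) * sin \<theta> = - (\<tau>\<^sub>0 (f p) * cos \<theta>)))"
proof -
  have main: "(\<exists>u. adapted_frame (\<Omega> c (snd c (f p))) (\<Upsilon> c (snd c (f p)))
          (complex_mult (\<Omega> c (snd c (f p))) (\<Upsilon> c (snd c (f p))) (cis (- \<theta> / 3)) ` range (local_diff f b c p)) u) \<and>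
      (\<forall>u. adapted_frame (\<Omega> c (snd c (f p))) (\<Upsilon> c (snd c (f p)))
          (complex_mult (\<Omega> c (snd c (f p))) (\<Upsilon> c (snd c (f p))) (cis (- \<theta> / 3)) ` range (local_diff f b c p)) u \<longrightarrow>
        \<tau>\<^sub>0h (f p) * sin \<theta> + \<tau>\<^sub>0 (f p) * cos \<theta> =
               sqrt 3 / 6 * (sin (\<theta> / 3) * ddagger (refined'' u (\<tau>\<^sub>3 c (snd c (f p))))
                             - cos (\<theta> / 3) * dagger (refined' u (\<tau>\<^sub>3 c (snd c (f p))))))"
    if bcp: "b \<in> B" "c \<in> A" "p \<in> fst b" "f p \<in> fst c" for p b c
  proof -
    let ?y = "snd c (f p)"
    let ?E = "range (local_diff f b c p)"
    have y: "?y \<in> chart_img c" using bcp by (simp add: chart_img_def)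
    have E: "special_lagrangian_plane (\<Omega> c ?y) (\<Upsilon> c ?y) \<theta> ?E"
      using assms(5) bcp unfolding special_lagrangian_3fold_def by auto
    obtain u0 where "su3_frame (\<Omega> c ?y) (\<Upsilon> c ?y) u0"
      using assms(2) bcp(2) y unfolding su3_structure_def by auto
    note ex = adapted_frame_exists[OF this E]
    have inv: "chart_inv c ?y = f p" by (rule chart_inv_apply[OF assms(1) bcp(2,4)])
    have t3: "\<tau>\<^sub>3 c ?y \<in> Lambda3_12 (\<Omega> c ?y) (\<Upsilon> c ?y)"
      and dO: "ext_deriv 2 (\<Omega> c) ?y = (\<lambda>v. 3 * \<tau>\<^sub>0 (f p) * Re_form (\<Upsilon> c ?y) v + 3 * \<tau>\<^sub>0h (f p) * Im_form (\<Upsilon> c ?y) v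
          + \<tau>\<^sub>3 c ?y v + wedge 1 2 (\<tau>\<^sub>4 c ?y) (\<Omega> c ?y) v)"
      using assms(3) bcp(2) y unfolding torsion_forms_def by (auto simp only: inv)
    have "diff_form A 2 \<Omega>" using assms(2) unfolding su3_structure_def by auto
    from dOmega_vanishes_on_special_lagrangian[OF assms(1) this assms(5) bcp]
    have d: "3 * \<tau>\<^sub>0 (f p) * Re_form (\<Upsilon> c ?y) v + 3 * \<tau>\<^sub>0h (f p) * Im_form (\<Upsilon> c ?y) v
          + \<tau>\<^sub>3 c ?y v + wedge 1 2 (\<tau>\<^sub>4 c ?y) (\<Omega> c ?y) v = 0" if "range v \<subseteq> ?E" for v
      using that unfolding dO by blast
    show ?thesis using ex adapted_frame_identity[OF E t3 d] by blast
  qed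
  have "\<tau>\<^sub>0h (f p) * sin \<theta> = - (\<tau>\<^sub>0 (f p) * cos \<theta>)"
    if z: "\<forall>c\<in>A. \<forall>y\<in>chart_img c. \<tau>\<^sub>3 c y = (\<lambda>v. 0)" and p: "p \<in> topspace Y" for p
  proof -
    have Y: "smooth_manifold Y B" and cont: "continuous_map Y X f"
      using assms(5) unfolding special_lagrangian_3fold_def immersion_def smooth_map_def by auto
    obtain b where b: "b \<in> B" "p \<in> fst b" using Y p unfolding smooth_manifold_def by blast
    have "f p \<in> topspace X" using cont p by (auto simp: continuous_map_def)
    then obtain c where c: "c \<in> A" "f p \<in> fst c" using assms(1) unfolding smooth_manifold_def by blast
    have t3: "\<tau>\<^sub>3 c (snd c (f p)) = (\<lambda>v. 0)" using z c by (auto simp: chart_img_def)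
    have "dagger (refined' u (\<lambda>v. 0)) = 0" "ddagger (refined'' u (\<lambda>v. 0)) = 0" for u
      using dagger_scale[of 0] by (simp_all add: refined'_def refined''_def line_proj_def pull_def form3_inner_def)
    with main[OF b(1) c(1) b(2) c(2)] show ?thesis unfolding t3 by auto
  qed
  with main show ?thesis unfolding Let_def by blast
qed

end
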